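(* For $t\ge2$, $g\in[t-1]$ let $T^{(t)}_g=\mathbb 1\{\max_{s\in\mathcal S^{(t)}}A^{(t)}_{s,g}/\xi^{(t)}_s>1\}$ with $\xi^{(t)}_s=\lambda z(s,p,t)$ for a tuning parameter $\lambda>0$, and $\hat\tau=\inf\{t\ge2:\max_{g\in G^{(t)}}T^{(t)}_g=1\}$. For every $\delta\in(0,1)$ there exist a constant $C_1>0$ depending only on $\delta$ and a constant $C_2>0$ depending only on $\lambda$ and $\delta$ such that: if $\lambda\ge C_1$ then $\mathbb P_\infty(\hat\tau<\infty)\le\delta$; and if $\tau<\infty$ and $\tau\phi^2/\sigma^2\ge C_2 z(k,p,2\tau)$, then $$\mathbb P_\tau\Big\{\hat\tau-\tau\le\Big\lceil C_2\frac{\sigma^2}{\phi^2}z(k,p,2\tau)\Big\rceil\Big\}\ge1-\delta.$$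
   Context: $\log$ is natural, $[n]=\{1,\dots,n\}$, $\inf\emptyset=\infty$. Model: $(Y_i)_{i\in\mathbb N}$ independent in $\mathbb R^p$; under $\mathbb P_\tau$ ($\tau\in\mathbb N\cup\{\infty\}$), $Y_i\sim N_p(\mu_1,\sigma^2I)$ for $i\le\tau$ and $Y_i\sim N_p(\mu_2,\sigma^2I)$ for $i>\tau$, with $\mu_1,\mu_2$ unknown and $\sigma>0$ known. $k=\|\mu_2-\mu_1\|_0$ (number of nonzero entries), $\phi=\|\mu_2-\mu_1\|_2$. CUSUM vector: $C^{(t)}_g=\{g/(t(t-g))\}^{1/2}\sum_{i=1}^{t-g}Y_i-\{(t-g)/(tg)\}^{1/2}\sum_{i=t-g+1}^tY_i$, with entries $C^{(t)}_g(j)$. Threshold: $a^2(s,t)=4\log(ep s^{-2}\log t)\,\mathbb 1\{s\le\sqrt{p\log t}\}$, $a(s,t)\ge0$. For $a\ge0$, $\nu_a=\mathbb E\{Z^2\mid |Z|>a\}$ with $Z\sim N(0,1)$. Statistic: $A^{(t)}_{s,g}=\sum_{j=1}^p\{C^{(t)}_g(j)^2/\sigma^2-\nu_{a(s,t)}\}\mathbb 1\{|C^{(t)}_g(j)|/\sigma>a(s,t)\}$. Sparsity grid: $\mathcal S^{(t)}=\{1,2,4,\dots,2^{\lfloor\log_2(\sqrt{p\log t}\wedge p)\rfloor}\}\cup\{p\}$. Function: $z(s,p,t)=\sqrt{p\log t}$ if $s>\sqrt{p\log t}$, and $z(s,p,t)=s\log\{ep\log t/s^2\}\vee\log t$ otherwise.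 Dynamic geometric grid: for $t\ge2$, $G^{(t)}=\{1\}\cup\bigcup_{j=1}^{\lfloor \log_2\{(t-1)/3\}\rfloor+1}\{g^{(t)}_{L,j}\}\cup\bigcup_{j=1}^{\lfloor\log_2(t-1)\rfloor-1}\{g^{(t)}_{R,j}\}$, $g^{(t)}_{L,j}=2^j+\{(t-1)\bmod 2^{j-1}\}$, $g^{(t)}_{R,j}=g^{(t)}_{L,j}+2^{j-1}$ (empty unions if upper index $<1$). *)

theory Defs
  imports "HOL-Probability.Probability"
begin

text \<open>Observations: Y (i,j) is coordinate j (0 \<le> j < p) of the observation at time i (i \<ge> 1).
Under P_tau, Y(i,j) ~ N(mu1 j, sigma^2) for i \<le> tau and N(mu2 j, sigma^2) for i > tau,
all independent (infinite product measure). Coordinates j \<ge> p and time 0 are unused dummies.\<close>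

definition Pmodel :: "real \<Rightarrow> (nat \<Rightarrow> real) \<Rightarrow> (nat \<Rightarrow> real) \<Rightarrow> enat \<Rightarrow> (nat \<times> nat \<Rightarrow> real) measure" where
  "Pmodel \<sigma> \<mu>1 \<mu>2 \<tau> =
     PiM UNIV (\<lambda>(i,j). density lborel
        (normal_density (if enat i \<le> \<tau> then \<mu>1 j else \<mu>2 j) \<sigma>))"

definition cusum :: "nat \<Rightarrow> nat \<Rightarrow> nat \<Rightarrow> (nat \<times> nat \<Rightarrow> real) \<Rightarrow> real" where
  "cusum t g j Y =
     sqrt (real g / (real t * (real t - real g))) * (\<Sum>i=1..t-g. Y (i,j))
     - sqrt ((real t - real g) / (real t * real g)) * (\<Sum>i=t-g+1..t. Y (i,j))"

definition thr :: "nat \<Rightarrow> nat \<Rightarrow> nat \<Rightarrow> real" where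
  "thr p s t = sqrt (4 * ln (exp 1 * real p * (real s)\<^sup>2 powi (-1) * ln (real t))
                   * (if real s \<le> sqrt (real p * ln (real t)) then 1 else 0))"

definition nu :: "real \<Rightarrow> real" where
  "nu a = (LINT x:{x. a < \<bar>x\<bar>}|lborel. x\<^sup>2 * std_normal_density x)
          / (LINT x:{x. a < \<bar>x\<bar>}|lborel. std_normal_density x)"

definition Astat :: "nat \<Rightarrow> real \<Rightarrow> nat \<Rightarrow> nat \<Rightarrow> nat \<Rightarrow> (nat \<times> nat \<Rightarrow> real) \<Rightarrow> real" where
  "Astat p \<sigma> t s g Y =
     (\<Sum>j<p. ((cusum t g j Y)\<^sup>2 / \<sigma>\<^sup>2 - nu (thr p s t))
              * (if \<bar>cusum t g j Y\<bar> / \<sigma> > thr p s t then 1 else 0))"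

definition Sgrid :: "nat \<Rightarrow> nat \<Rightarrow> nat set" where
  "Sgrid p t = {2 ^ i | i::nat. int i \<le> \<lfloor>log 2 (min (sqrt (real p * ln (real t))) (real p))\<rfloor>} \<union> {p}"

definition zfun :: "real \<Rightarrow> nat \<Rightarrow> real \<Rightarrow> real" where
  "zfun s p t = (if s > sqrt (real p * ln t) then sqrt (real p * ln t)
                 else max (s * ln (exp 1 * real p * ln t / s\<^sup>2)) (ln t))"

definition gL :: "nat \<Rightarrow> nat \<Rightarrow> nat" where
  "gL t j = 2 ^ j + ((t - 1) mod 2 ^ (j - 1))"

definition gR :: "nat \<Rightarrow> nat \<Rightarrow> nat" where
  "gR t j = gL t j + 2 ^ (j - 1)"

definition Ggrid :: "nat \<Rightarrow> nat set" where
  "Ggrid t = {1}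
     \<union> {gL t j | j. 1 \<le> j \<and> int j \<le> \<lfloor>log 2 ((real t - 1) / 3)\<rfloor> + 1}
     \<union> {gR t j | j. 1 \<le> j \<and> int j \<le> \<lfloor>log 2 (real t - 1)\<rfloor> - 1}"

definition Tstat :: "nat \<Rightarrow> real \<Rightarrow> real \<Rightarrow> nat \<Rightarrow> nat \<Rightarrow> (nat \<times> nat \<Rightarrow> real) \<Rightarrow> nat" where
  "Tstat p \<sigma> lam t g Y =
     (if Max ((\<lambda>s. Astat p \<sigma> t s g Y / (lam * zfun (real s) p (real t))) ` Sgrid p t) > 1
      then 1 else 0)"

text \<open>Stopping time hat tau = inf {t \<ge> 2 : max_{g in G(t)} T_g = 1}, with inf {} = \<infinity>.\<close>
definition tauhat :: "nat \<Rightarrow> real \<Rightarrow> real \<Rightarrow> (nat \<times> nat \<Rightarrow> real) \<Rightarrow> enat" where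
  "tauhat p \<sigma> lam Y = Inf {enat t | t. t \<ge> 2 \<and> Max ((\<lambda>g. Tstat p \<sigma> lam t g Y) ` Ggrid t) = 1}"

definition sparsity :: "nat \<Rightarrow> (nat \<Rightarrow> real) \<Rightarrow> (nat \<Rightarrow> real) \<Rightarrow> nat" where
  "sparsity p \<mu>1 \<mu>2 = card {j. j < p \<and> \<mu>2 j - \<mu>1 j \<noteq> 0}"

definition l2diff :: "nat \<Rightarrow> (nat \<Rightarrow> real) \<Rightarrow> (nat \<Rightarrow> real) \<Rightarrow> real" where
  "l2diff p \<mu>1 \<mu>2 = sqrt (\<Sum>j<p. (\<mu>2 j - \<mu>1 j)\<^sup>2)"

end

theory Submission
  imports Defs "HOL-Real_Asymp.Real_Asymp"
begin

text \<open>Write \<open>W\<^sub>a(x) = (x\<^sup>2 - \<nu>\<^sub>a) 1{\<bar>x\<bar> > a}\<close>. For a standard normal \<open>Z\<close>, \<open>W\<^sub>a(Z)\<close> has mean zero,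
  and since \<open>a\<^sup>2 \<le> \<nu>\<^sub>a \<le> a\<^sup>2 + 2\<close> it satisfies \<open>\<bar>W\<^sub>a(x)\<bar> \<le> x\<^sup>2 + 2\<close> and vanishes below \<open>a\<close>. A second-order
  expansion therefore gives \<open>E exp (\<eta> W\<^sub>a(Z)) \<le> exp (2048 \<eta>\<^sup>2 exp (- a\<^sup>2/4))\<close> for \<open>\<bar>\<eta>\<bar> \<le> 1/16\<close>, and the
  threshold is tuned so that \<open>p exp (- a\<^sup>2/4) = s\<^sup>2/(e log t)\<close>. Chernoff's inequality for the independent
  CUSUM entries then controls both the upper tail of the statistic without change and its lower
  tail under the change.

  For the false alarm bound, \<open>\<eta>\<close> is taken of order \<open>1\<close> for \<open>s \<le> log t\<close>, \<open>log t / s\<close> for larger sparse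
  \<open>s\<close>, and \<open>(log t / p)\<^sup>1\<^sup>/\<^sup>2\<close> in the dense case; the union bound over all \<open>g < t\<close>, \<open>s\<close> and \<open>t\<close> is summable.
  For the delay, at time \<open>t = \<tau> + d\<close> the grid contains some \<open>g \<in> (d/4, d]\<close>, for which the squared norm of
  the CUSUM mean is at least \<open>d \<phi>\<^sup>2/16\<close>. The statistic with \<open>s = p\<close> if \<open>k\<close> is dense, and otherwise with \<open>s\<close>
  the largest power of two below \<open>k\<close>, exceeds its threshold.\<close>

section \<open>Gaussian integrals\<close>

text \<open>The exponents -x^2/2 and 3x^2/8 add up to -x^2/8, so the integrand is twice the density
  of a centred normal law with standard deviation 2.\<close>

lemma has_bochner_integral_std_normal_exp_square:
  "has_bochner_integral lborel (\<lambda>x. std_normal_density x * exp (3 * x\<^sup>2 / 8)) 2"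
proof -
  have "has_bochner_integral lborel (\<lambda>x. 2 * normal_density 0 2 x) (2 * 1)"
    by (intro has_bochner_integral_mult_right)
       (auto simp: has_bochner_integral_iff integral_normal_density)
  also have "(\<lambda>x. 2 * normal_density 0 2 x) = (\<lambda>x. std_normal_density x * exp (3 * x\<^sup>2 / 8))"
  proof
    fix x :: real
    have "sqrt 8 = 2 * sqrt (2::real)"
      using real_sqrt_mult[of 4 2] by simp
    moreover have "exp (- (x\<^sup>2 / 2)) * exp (3 * x\<^sup>2 / 8) = exp (- (x\<^sup>2 / 8))"
      unfolding mult_exp_exp by simp
    ultimately show "2 * normal_density 0 2 x = std_normal_density x * exp (3 * x\<^sup>2 / 8)"
      by (simp add: normal_density_def real_sqrt_mult)
  qed
  finally show ?thesis by simp
qed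

text \<open>Where a \<le> |x|, the factor exp((x^2 - a^2)/4) is at least 1. Inserting it extracts
  exp(-a^2/4) and leaves the integrable weight exp(3x^2/8).\<close>

lemma
  fixes a :: real
  assumes "0 \<le> a"
  shows integrable_std_normal_tail_exp:
      "integrable lborel (\<lambda>x. std_normal_density x * (indicator {x. a \<le> \<bar>x\<bar>} x * exp (x\<^sup>2 / 8)))"
    and integral_std_normal_tail_exp_le:
      "(LINT x|lborel. std_normal_density x * (indicator {x. a \<le> \<bar>x\<bar>} x * exp (x\<^sup>2 / 8)))
         \<le> 2 * exp (- a\<^sup>2 / 4)"
proof -
  have bound: "std_normal_density x * (indicator {x. a \<le> \<bar>x\<bar>} x * exp (x\<^sup>2 / 8))
      \<le> exp (- a\<^sup>2 / 4) * (std_normal_density x * exp (3 * x\<^sup>2 / 8))" for x :: real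
  proof (cases "a \<le> \<bar>x\<bar>")
    case True
    then have "a\<^sup>2 \<le> x\<^sup>2" using assms by (simp add: abs_le_square_iff[symmetric])
    then have "exp (x\<^sup>2 / 8) \<le> exp (- a\<^sup>2 / 4) * exp (3 * x\<^sup>2 / 8)"
      unfolding mult_exp_exp by simp
    then have "std_normal_density x * exp (x\<^sup>2 / 8)
        \<le> std_normal_density x * (exp (- a\<^sup>2 / 4) * exp (3 * x\<^sup>2 / 8))"
      by (intro mult_left_mono) auto
    then show ?thesis using True by (simp add: algebra_simps)
  qed auto
  have int: "integrable lborel (\<lambda>x. exp (- a\<^sup>2 / 4) * (std_normal_density x * exp (3 * x\<^sup>2 / 8)))"
    using has_bochner_integral_std_normal_exp_square by (auto simp: has_bochner_integral_iff)
  show *: "integrable lborel (\<lambda>x. std_normal_density x * (indicator {x. a \<le> \<bar>x\<bar>} x * exp (x\<^sup>2 / 8)))"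
    by (rule Bochner_Integration.integrable_bound[OF int]) (use bound in \<open>auto intro!: AE_I2 simp: abs_mult\<close>)
  have "(LINT x|lborel. std_normal_density x * (indicator {x. a \<le> \<bar>x\<bar>} x * exp (x\<^sup>2 / 8)))
      \<le> (LINT x|lborel. exp (- a\<^sup>2 / 4) * (std_normal_density x * exp (3 * x\<^sup>2 / 8)))"
    by (intro integral_mono * int bound)
  also have "\<dots> = 2 * exp (- a\<^sup>2 / 4)"
    using has_bochner_integral_std_normal_exp_square by (auto simp: has_bochner_integral_iff)
  finally show "(LINT x|lborel. std_normal_density x * (indicator {x. a \<le> \<bar>x\<bar>} x * exp (x\<^sup>2 / 8)))
         \<le> 2 * exp (- a\<^sup>2 / 4)" .
qed

text \<open>The Lagrange remainder is exp(t)/2 at some |t| \<le> |u| \<le> v.\<close>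

lemma exp_le_quadratic:
  fixes u v :: real
  assumes "\<bar>u\<bar> \<le> v"
  shows "exp u \<le> 1 + u + u\<^sup>2 * exp v"
proof -
  obtain t where t: "\<bar>t\<bar> \<le> \<bar>u\<bar>" and eq: "exp u = 1 + u + exp t / 2 * u\<^sup>2"
    using Maclaurin_exp_le[of u 2] by (auto simp: numeral_2_eq_2 algebra_simps)
  have "exp t / 2 \<le> exp v"
    using t assms by (smt (verit) exp_gt_zero exp_le_cancel_iff field_sum_of_halves)
  then have "exp t / 2 * u\<^sup>2 \<le> exp v * u\<^sup>2" by (intro mult_right_mono) auto
  then show ?thesis unfolding eq by (simp add: mult.commute)
qed

text \<open>The linear term integrates to zero by \<open>mean\<close>; the quadratic term lives on a
  \<le> |x|, where it gains exp(-a^2/4). A general \<open>W\<close> covers truncated and plain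
  squares, and either sign of \<eta> serves both tails.\<close>

lemma nn_integral_std_normal_exp_le:
  fixes a \<eta> :: real and W :: "real \<Rightarrow> real"
  assumes "0 \<le> a" and [measurable]: "W \<in> borel_measurable borel"
    and W: "\<And>x. \<bar>W x\<bar> \<le> x\<^sup>2 + 2" "\<And>x. \<bar>x\<bar> < a \<Longrightarrow> W x = 0"
    and mean: "(LINT x|lborel. std_normal_density x * W x) = 0"
    and \<eta>: "\<bar>\<eta>\<bar> \<le> 1 / 16"
  shows "(\<integral>\<^sup>+x. ennreal (std_normal_density x) * ennreal (exp (\<eta> * W x)) \<partial>lborel)
          \<le> ennreal (exp (2048 * \<eta>\<^sup>2 * exp (- a\<^sup>2 / 4)))"
proof -
  define R where "R x = indicator {x. a \<le> \<bar>x\<bar>} x * exp (x\<^sup>2 / 8)" for x :: real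
  have pt: "exp (\<eta> * W x) \<le> 1 + \<eta> * W x + 1024 * \<eta>\<^sup>2 * R x" for x
  proof (cases "a \<le> \<bar>x\<bar>")
    case True
    \<comment> \<open>This bounds |\<eta> W(x)|. The constant 1024 arises from (16y)^2 = 256y^2
      \<le> 512 exp(y) and exp(2y) = exp(1/4) exp(x^2/8) \<le> 2 exp(x^2/8).\<close>
    define y where "y = (x\<^sup>2 + 2) / 16"
    have y: "0 \<le> y" by (simp add: y_def)
    have "\<bar>\<eta> * W x\<bar> \<le> 1 / 16 * (x\<^sup>2 + 2)"
      unfolding abs_mult using \<eta> W(1)[of x] by (intro mult_mono) auto
    then have "exp (\<eta> * W x) \<le> 1 + \<eta> * W x + (\<eta> * W x)\<^sup>2 * exp y"
      by (intro exp_le_quadratic) (simp add: y_def)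
    moreover have "(\<eta> * W x)\<^sup>2 * exp y \<le> \<eta>\<^sup>2 * (1024 * exp (x\<^sup>2 / 8))"
    proof -
      have "\<bar>W x\<bar> \<le> \<bar>16 * y\<bar>" using W(1)[of x] by (simp add: y_def)
      then have "(W x)\<^sup>2 \<le> (16 * y)\<^sup>2" by (simp only: abs_le_square_iff)
      also have "\<dots> \<le> 512 * exp y"
        using exp_lower_Taylor_quadratic[OF y] y by (simp add: power_mult_distrib)
      finally have "(W x)\<^sup>2 * exp y \<le> 512 * exp y * exp y"
        by (intro mult_right_mono) auto
      also have "\<dots> = 512 * (exp (1/4) * exp (x\<^sup>2 / 8))"
        unfolding mult.assoc mult_exp_exp by (simp add: y_def field_simps)
      also have "\<dots> \<le> 512 * (2 * exp (x\<^sup>2 / 8))"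
        using exp_bound_half[of "1/4::real"] by (intro mult_left_mono mult_right_mono) auto
      finally show ?thesis
        by (simp add: power_mult_distrib mult.assoc mult_left_mono)
    qed
    ultimately show ?thesis using True by (simp add: R_def algebra_simps)
  next
    case False
    then show ?thesis using W(2)[of x] by (simp add: R_def)
  qed
  have int1: "integrable lborel (\<lambda>x. std_normal_density x * W x)"
  proof (rule Bochner_Integration.integrable_bound)
    show "integrable lborel (\<lambda>x. std_normal_density x * x^2 + 2 * (std_normal_density x * x^0))"
      by (intro Bochner_Integration.integrable_add integrable_mult_right integrable_std_normal_moment)
    show "AE x in lborel. norm (std_normal_density x * W x)
        \<le> norm (std_normal_density x * x^2 + 2 * (std_normal_density x * x^0))"
    proof (rule AE_I2)
      fix x :: real
      have "std_normal_density x * \<bar>W x\<bar> \<le> std_normal_density x * (x\<^sup>2 + 2)"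
        by (intro mult_left_mono W) auto
      then show "norm (std_normal_density x * W x)
        \<le> norm (std_normal_density x * x^2 + 2 * (std_normal_density x * x^0))"
        by (auto simp: abs_mult algebra_simps)
    qed
  qed auto
  have int2: "integrable lborel (\<lambda>x. std_normal_density x * R x)"
    unfolding R_def by (rule integrable_std_normal_tail_exp) fact
  have int0: "integrable lborel std_normal_density" by simp
  let ?f = "\<lambda>x. std_normal_density x + \<eta> * (std_normal_density x * W x)
      + 1024 * \<eta>\<^sup>2 * (std_normal_density x * R x)"
  have intf: "integrable lborel ?f"
    using int0 int1 int2 by auto
  have nn: "std_normal_density x * exp (\<eta> * W x) \<le> ?f x" for x
    using mult_left_mono[OF pt[of x], of "std_normal_density x"] by (simp add: algebra_simps)
  have nn0: "0 \<le> ?f x" for x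
    by (rule order_trans[OF _ nn]) auto
  have "(\<integral>\<^sup>+x. ennreal (std_normal_density x) * ennreal (exp (\<eta> * W x)) \<partial>lborel)
      \<le> (\<integral>\<^sup>+x. ennreal (?f x) \<partial>lborel)"
    using nn by (intro nn_integral_mono) (simp flip: ennreal_mult' add: ennreal_leI)
  also have "\<dots> = ennreal (LINT x|lborel. ?f x)"
    by (rule nn_integral_eq_integral[OF intf]) (use nn0 in auto)
  also have "(LINT x|lborel. ?f x) = 1 + 1024 * \<eta>\<^sup>2 * (LINT x|lborel. std_normal_density x * R x)"
    using int0 int1 int2 mean by (simp add: integral_normal_density)
  also have "\<dots> \<le> 1 + 1024 * \<eta>\<^sup>2 * (2 * exp (- a\<^sup>2 / 4))"
    unfolding R_def by (intro add_left_mono mult_left_mono integral_std_normal_tail_exp_le) (use assms in auto)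
  also have "\<dots> \<le> exp (2048 * \<eta>\<^sup>2 * exp (- a\<^sup>2 / 4))"
    using exp_ge_add_one_self[of "2048 * \<eta>\<^sup>2 * exp (- a\<^sup>2 / 4)"] by (simp add: algebra_simps)
  finally show ?thesis by (simp add: ennreal_leI)
qed

text \<open>The function (a - x) times the density is an antiderivative, and it vanishes both at a
  and at infinity.\<close>

lemma integral_std_normal_antiderivative:
  fixes a :: real
  shows "(LINT x|lborel. indicator {a<..} x * (std_normal_density x * (x\<^sup>2 - a * x - 1))) = 0"
proof -
  let ?f = "\<lambda>x. std_normal_density x * (x\<^sup>2 - a * x - 1)"
  let ?F = "\<lambda>x. (a - x) * std_normal_density x"
  have "integrable lborel (\<lambda>x. std_normal_density x * x^2 - a * (std_normal_density x * x^1) - std_normal_density x * x^0)"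
    by (intro Bochner_Integration.integrable_diff integrable_mult_right integrable_std_normal_moment)
  then have int: "integrable lborel ?f"
    by (simp add: algebra_simps)
  have "(LBINT x=ereal a..\<infinity>. ?f x) = 0 - 0"
  proof (rule interval_integral_FTC_integrable)
    show "set_integrable lborel (einterval (ereal a) \<infinity>) ?f"
      unfolding set_integrable_def
      by (intro integrable_mult_indicator int) (auto simp: einterval_def)
    define c where "c = 1 / sqrt (2 * pi)"
    have c: "std_normal_density x = c * exp (- x\<^sup>2 / 2)" for x
      by (simp add: std_normal_density_def c_def)
    show "(?F has_vector_derivative ?f x) (at x)" for x
      unfolding c has_real_derivative_iff_has_vector_derivative[symmetric]
      by (auto intro!: derivative_eq_intros simp: field_simps power2_eq_square)
    show "isCont ?f x" for x
      unfolding std_normal_density_def by (intro continuous_intros) auto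
    have "isCont ?F a" unfolding std_normal_density_def by (intro continuous_intros) auto
    then have "(?F \<longlongrightarrow> ?F a) (at_right a)"
      unfolding isCont_def by (rule filterlim_mono) (auto simp: at_within_le_at)
    then show "((?F \<circ> real_of_ereal) \<longlongrightarrow> 0) (at_right (ereal a))"
      by (simp add: ereal_tendsto_simps)
    have "(?F \<longlongrightarrow> 0) at_top"
      unfolding std_normal_density_def by real_asymp
    then show "((?F \<circ> real_of_ereal) \<longlongrightarrow> 0) (at_left \<infinity>)"
      by (simp add: ereal_tendsto_simps)
  qed auto
  then show ?thesis
    by (simp add: interval_lebesgue_integral_def set_lebesgue_integral_def einterval_def greaterThan_def)
qed

section \<open>Bounds on the truncated second moment \<open>nu\<close>\<close>

context
  fixes a :: real
  assumes a: "0 \<le> a"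
begin

lemma integrable_std_normal_tail:
  "integrable lborel (\<lambda>x. indicator {x. a < \<bar>x\<bar>} x * (std_normal_density x * x^k))"
  by (rule integrable_real_mult_indicator[OF _ integrable_std_normal_moment, unfolded mult.commute[of _ "indicator _ _"]]) auto

text \<open>This is the denominator of \<open>nu\<close>; its positivity makes \<open>nu\<close> a
  genuine conditional mean instead of the default value of a division by zero.\<close>

lemma std_normal_tail_pos:
  "0 < (LINT x:{x. a < \<bar>x\<bar>}|lborel. std_normal_density x)"
proof -
  have "0 < std_normal_density (a + 2)" by (rule normal_density_pos) simp
  also have "\<dots> = (LINT x|lborel. indicator {a + 1..a + 2} x * std_normal_density (a + 2))"
    by simp
  also have "\<dots> \<le> (LINT x|lborel. indicator {x. a < \<bar>x\<bar>} x * (std_normal_density x * x^0))"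
  proof (intro integral_mono integrable_std_normal_tail)
    show "indicat_real {a + 1..a + 2} x * std_normal_density (a + 2)
      \<le> indicat_real {x. a < \<bar>x\<bar>} x * (std_normal_density x * x ^ 0)" for x
    proof (cases "x \<in> {a + 1..a + 2}")
      case True
      then have "x\<^sup>2 \<le> (a + 2)\<^sup>2" using a by (intro power_mono) auto
      then have "std_normal_density (a + 2) \<le> std_normal_density x"
        unfolding std_normal_density_def by (intro mult_left_mono) auto
      then show ?thesis using True a by auto
    qed auto
  qed auto
  finally show ?thesis by (simp add: set_lebesgue_integral_def)
qed

lemma nu_mult_tail:
  "nu a * (LINT x:{x. a < \<bar>x\<bar>}|lborel. std_normal_density x)
     = (LINT x:{x. a < \<bar>x\<bar>}|lborel. x\<^sup>2 * std_normal_density x)"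
  using std_normal_tail_pos by (simp add: nu_def)

text \<open>Subtracting the conditional mean of the square on the tail event centres the truncated
  square.\<close>

lemma integral_std_normal_centred:
  "(LINT x|lborel. std_normal_density x * ((x\<^sup>2 - nu a) * indicator {x. a < \<bar>x\<bar>} x)) = 0"
proof -
  have "(LINT x|lborel. std_normal_density x * ((x\<^sup>2 - nu a) * indicator {x. a < \<bar>x\<bar>} x))
     = (LINT x|lborel. indicator {x. a < \<bar>x\<bar>} x * (std_normal_density x * x^2)
         - nu a * (indicator {x. a < \<bar>x\<bar>} x * (std_normal_density x * x^0)))"
    by (intro Bochner_Integration.integral_cong) (auto simp: algebra_simps)
  also have "\<dots> = (LINT x|lborel. indicator {x. a < \<bar>x\<bar>} x * (std_normal_density x * x^2))
         - nu a * (LINT x|lborel. indicator {x. a < \<bar>x\<bar>} x * (std_normal_density x * x^0))"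
    by (subst Bochner_Integration.integral_diff) (intro integrable_mult_right integrable_std_normal_tail | simp)+
  also have "\<dots> = 0"
    using nu_mult_tail by (simp add: set_lebesgue_integral_def mult_ac)
  finally show ?thesis .
qed

text \<open>The square exceeds a^2 throughout the conditioning event.\<close>

lemma nu_ge: "a\<^sup>2 \<le> nu a"
proof -
  let ?Q = "LINT x:{x. a < \<bar>x\<bar>}|lborel. std_normal_density x"
  have "a\<^sup>2 * ?Q = (LINT x|lborel. a\<^sup>2 * (indicator {x. a < \<bar>x\<bar>} x * (std_normal_density x * x^0)))"
    by (simp add: set_lebesgue_integral_def)
  also have "\<dots> \<le> (LINT x|lborel. indicator {x. a < \<bar>x\<bar>} x * (std_normal_density x * x^2))"
  proof (intro integral_mono integrable_mult_right integrable_std_normal_tail)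
    show "a\<^sup>2 * (indicat_real {x. a < \<bar>x\<bar>} x * (std_normal_density x * x ^ 0))
         \<le> indicat_real {x. a < \<bar>x\<bar>} x * (std_normal_density x * x\<^sup>2)" for x
    proof (cases "a < \<bar>x\<bar>")
      case True
      then have "a\<^sup>2 \<le> x\<^sup>2" using a by (simp add: abs_le_square_iff[symmetric])
      then show ?thesis using True by (simp add: mult.commute mult_left_mono)
    qed auto
  qed
  also have "\<dots> = nu a * ?Q"
    unfolding nu_mult_tail by (simp add: set_lebesgue_integral_def mult_ac)
  finally show ?thesis using std_normal_tail_pos by simp
qed

text \<open>Up to reflection, \<open>x\<^sup>2 - a \<bar>x\<bar> - 1\<close> integrates to zero over the tail, and
  it dominates \<open>(x\<^sup>2 - a\<^sup>2 - 2) / 2\<close>.\<close>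
lemma nu_le: "nu a \<le> a\<^sup>2 + 2"
proof -
  let ?Q = "LINT x:{x. a < \<bar>x\<bar>}|lborel. std_normal_density x"
  let ?I = "\<lambda>x. indicator {a<..} x * (std_normal_density x * (x\<^sup>2 - a * x - 1)) :: real"
  have int1: "integrable lborel ?I"
  proof -
    have "integrable lborel (\<lambda>x. std_normal_density x * x^2 - a * (std_normal_density x * x^1) - std_normal_density x * x^0)"
      by (intro Bochner_Integration.integrable_diff integrable_mult_right integrable_std_normal_moment)
    then have "integrable lborel (\<lambda>x. indicator {a<..} x *\<^sub>R (std_normal_density x * x^2 - a * (std_normal_density x * x^1) - std_normal_density x * x^0))"
      by (intro integrable_mult_indicator) auto
    then show ?thesis by (simp add: algebra_simps)
  qed
  have int2: "integrable lborel (\<lambda>x. ?I (- x))"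
    using lborel_integrable_real_affine_iff[of "-1" ?I 0] int1 by simp
  have eq2: "(LINT x|lborel. ?I (- x)) = (LINT x|lborel. ?I x)"
    using lborel_integral_real_affine[of "-1" ?I 0] by simp
  have "nu a * ?Q - (a\<^sup>2 + 2) * ?Q
      = (LINT x|lborel. indicator {x. a < \<bar>x\<bar>} x * (std_normal_density x * x^2))
         - (a\<^sup>2 + 2) * (LINT x|lborel. indicator {x. a < \<bar>x\<bar>} x * (std_normal_density x * x^0))"
    unfolding nu_mult_tail by (simp add: set_lebesgue_integral_def mult_ac)
  also have "\<dots> = (LINT x|lborel. indicator {x. a < \<bar>x\<bar>} x * (std_normal_density x * x^2)
         - (a\<^sup>2 + 2) * (indicator {x. a < \<bar>x\<bar>} x * (std_normal_density x * x^0)))"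
    by (subst Bochner_Integration.integral_diff) (intro integrable_mult_right integrable_std_normal_tail | simp)+
  also have "\<dots> \<le> (LINT x|lborel. 2 * (?I x + ?I (- x)))"
  proof (intro integral_mono integrable_mult_right Bochner_Integration.integrable_diff
      Bochner_Integration.integrable_add integrable_std_normal_tail int1 int2)
    fix x :: real
    have *: "y\<^sup>2 - (a\<^sup>2 + 2) \<le> 2 * (y\<^sup>2 - a * y - 1)" for y
      using zero_le_power2[of "y - a"] by (simp add: power2_eq_square algebra_simps)
    have m: "std_normal_density x * (y\<^sup>2 - (a\<^sup>2 + 2)) \<le> std_normal_density x * (2 * (y\<^sup>2 - a * y - 1))" for y
      by (intro mult_left_mono *) auto
    have e: "std_normal_density (- x) = std_normal_density x" by (simp add: std_normal_density_def)
    \<comment> \<open>As a \<ge> 0, each tail point belongs to exactly one of the two one-sided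
      integrands.\<close>
    show "indicat_real {x. a < \<bar>x\<bar>} x * (std_normal_density x * x\<^sup>2) -
         (a\<^sup>2 + 2) * (indicat_real {x. a < \<bar>x\<bar>} x * (std_normal_density x * x ^ 0))
         \<le> 2 * (?I x + ?I (- x))"
      using m[of x] m[of "- x"] a unfolding e
      by (auto simp: indicator_def algebra_simps split: if_splits)
  qed
  also have "\<dots> = 0"
    using int1 int2 eq2 integral_std_normal_antiderivative[of a] by simp
  finally have "nu a * ?Q \<le> (a\<^sup>2 + 2) * ?Q" by simp
  then show ?thesis using std_normal_tail_pos by simp
qed

end

lemma integral_std_normal_square_centred:
  "(LINT x|lborel. std_normal_density x * (x\<^sup>2 - 1)) = 0"
proof -
  have "(LINT x|lborel. std_normal_density x * (x\<^sup>2 - 1))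
      = (LINT x|lborel. std_normal_density x * x^(2 * 1) - std_normal_density x * x^(2 * 0))"
    by (simp add: right_diff_distrib)
  also have "\<dots> = 0"
    by (subst Bochner_Integration.integral_diff)
       (simp_all only: integrable_std_normal_moment integral_std_normal_moment_even, simp)
  finally show ?thesis .
qed

section \<open>The noise of the CUSUM statistic\<close>

text \<open>Markov's inequality for the exponential of the sum, whose mean factorises by
  independence. The rate is absorbed into \<open>f j\<close>, which may vary with j so that linear
  forms in the noise are covered.\<close>

lemma (in prob_space) chernoff_std_normal:
  assumes J: "finite J" and ind: "indep_vars (\<lambda>_. borel) Z J"
    and Z: "\<And>j. j \<in> J \<Longrightarrow> distributed M lborel (Z j) std_normal_density"
    and f[measurable]: "\<And>j. f j \<in> borel_measurable borel"
    and v: "\<And>j. j \<in> J \<Longrightarrow>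
      (\<integral>\<^sup>+x. ennreal (std_normal_density x) * ennreal (exp (f j x)) \<partial>lborel) \<le> ennreal (exp (v j))"
  shows "prob {\<omega> \<in> space M. x \<le> (\<Sum>j\<in>J. f j (Z j \<omega>))} \<le> exp ((\<Sum>j\<in>J. v j) - x)"
proof -
  have rv[measurable]: "j \<in> J \<Longrightarrow> random_variable borel (Z j)" for j
    using ind by (auto simp: indep_vars_def)
  have "emeasure M ({\<omega> \<in> space M. 1 \<le> ennreal (exp (- x)) * ennreal (exp (\<Sum>j\<in>J. f j (Z j \<omega>)))} \<inter> space M)
      \<le> ennreal (exp (- x)) * (\<integral>\<^sup>+\<omega>. ennreal (exp (\<Sum>j\<in>J. f j (Z j \<omega>))) * indicator (space M) \<omega> \<partial>M)"
    using nn_integral_Markov_inequality[where A="space M" and M=M and c="ennreal (exp (- x))" and u="\<lambda>\<omega>. ennreal (exp (\<Sum>j\<in>J. f j (Z j \<omega>)))"]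
    by (simp add: J)
  also have "{\<omega> \<in> space M. 1 \<le> ennreal (exp (- x)) * ennreal (exp (\<Sum>j\<in>J. f j (Z j \<omega>)))} \<inter> space M
      = {\<omega> \<in> space M. x \<le> (\<Sum>j\<in>J. f j (Z j \<omega>))}"
    by (auto simp: ennreal_mult'[symmetric] mult_exp_exp)
  also have "(\<integral>\<^sup>+\<omega>. ennreal (exp (\<Sum>j\<in>J. f j (Z j \<omega>))) * indicator (space M) \<omega> \<partial>M)
      = (\<integral>\<^sup>+\<omega>. (\<Prod>j\<in>J. ennreal (exp (f j (Z j \<omega>)))) \<partial>M)"
    by (intro nn_integral_cong) (auto simp: exp_sum[OF J] prod_ennreal)
  also have "\<dots> = (\<Prod>j\<in>J. \<integral>\<^sup>+\<omega>. ennreal (exp (f j (Z j \<omega>))) \<partial>M)"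
    by (intro indep_vars_nn_integral J indep_vars_compose2[OF ind]) auto
  also have "\<dots> \<le> (\<Prod>j\<in>J. ennreal (exp (v j)))"
  proof (intro prod_mono_ennreal)
    fix j assume j: "j \<in> J"
    have "(\<integral>\<^sup>+\<omega>. ennreal (exp (f j (Z j \<omega>))) \<partial>M)
        = (\<integral>\<^sup>+x. ennreal (std_normal_density x) * ennreal (exp (f j x)) \<partial>lborel)"
      by (rule distributed_nn_integral[OF Z[OF j], symmetric]) simp
    then show "(\<integral>\<^sup>+\<omega>. ennreal (exp (f j (Z j \<omega>))) \<partial>M) \<le> ennreal (exp (v j))"
      using v[OF j] by simp
  qed
  also have "\<dots> = ennreal (exp (\<Sum>j\<in>J. v j))"
    by (simp add: exp_sum[OF J] prod_ennreal)
  finally have "emeasure M {\<omega> \<in> space M. x \<le> (\<Sum>j\<in>J. f j (Z j \<omega>))} \<le> ennreal (exp ((\<Sum>j\<in>J. v j) - x))"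
    by (simp add: ennreal_mult'[symmetric] mult_exp_exp mult_left_mono)
  then show ?thesis
    unfolding emeasure_eq_measure by simp
qed

section \<open>The Gaussian product model and the law of the CUSUM noise\<close>

definition obs_mean :: "(nat \<Rightarrow> real) \<Rightarrow> (nat \<Rightarrow> real) \<Rightarrow> enat \<Rightarrow> nat \<times> nat \<Rightarrow> real" where
  "obs_mean \<mu>1 \<mu>2 \<tau> = (\<lambda>(i, j). if enat i \<le> \<tau> then \<mu>1 j else \<mu>2 j)"

context
  fixes \<sigma> :: real and \<mu>1 \<mu>2 :: "nat \<Rightarrow> real" and \<tau> :: enat
  assumes \<sigma>: "0 < \<sigma>"
begin

private abbreviation (input) "coord \<equiv> (\<lambda>(i, j). density lborel (normal_density (if enat i \<le> \<tau> then \<mu>1 j else \<mu>2 j) \<sigma>))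
   :: nat \<times> nat \<Rightarrow> real measure"

lemma sets_coord[simp]: "sets (coord ij) = sets borel"
  by (cases ij) simp

lemma product_prob_space_coord: "product_prob_space coord"
proof -
  have "prob_space (coord ij)" for ij
    using \<sigma> by (cases ij) (auto intro: prob_space_normal_density)
  then show ?thesis
    by (intro product_prob_spaceI)
qed

lemma prob_space_Pmodel: "prob_space (Pmodel \<sigma> \<mu>1 \<mu>2 \<tau>)"
  unfolding Pmodel_def
  by (rule prob_space_PiM) (use \<sigma> in \<open>auto intro: prob_space_normal_density\<close>)

text \<open>The joint law of the coordinate projections is the product measure itself, which
  characterises independence.\<close>

lemma indep_vars_Pmodel:
  "prob_space.indep_vars (Pmodel \<sigma> \<mu>1 \<mu>2 \<tau>) (\<lambda>_. borel) (\<lambda>ij Y. Y ij) UNIV"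
proof -
  interpret P: product_prob_space coord UNIV by (rule product_prob_space_coord)
  have "P.indep_vars coord (\<lambda>ij Y. Y ij) UNIV"
    by (subst P.indep_vars_iff_distr_eq_PiM)
       (simp_all add: P.PiM_component restrict_def)
  \<comment> \<open>Composing with \<open>id\<close> only replaces each target space by
    \<open>borel\<close>, which has the same measurable sets.\<close>
  then have "P.indep_vars (\<lambda>_. borel) (\<lambda>ij Y. id (Y ij)) UNIV"
    by (rule P.indep_vars_compose2) (simp add: measurable_def)
  then show ?thesis by (simp add: Pmodel_def)
qed

lemma distributed_Pmodel:
  "distributed (Pmodel \<sigma> \<mu>1 \<mu>2 \<tau>) lborel (\<lambda>Y. Y ij) (normal_density (obs_mean \<mu>1 \<mu>2 \<tau> ij) \<sigma>)"
proof -
  interpret P: product_prob_space coord UNIV by (rule product_prob_space_coord)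
  have "distr (PiM UNIV coord) lborel (\<lambda>Y. Y ij) = distr (PiM UNIV coord) (coord ij) (\<lambda>Y. Y ij)"
    by (intro distr_cong) simp_all
  also have "\<dots> = coord ij" by (rule P.PiM_component) simp
  finally show ?thesis
    using measurable_component_singleton[of ij UNIV coord]
    by (auto simp: distributed_def Pmodel_def obs_mean_def split: prod.splits cong: measurable_cong_sets)
qed

end

definition noise :: "real \<Rightarrow> (nat \<times> nat \<Rightarrow> real) \<Rightarrow> nat \<Rightarrow> nat \<Rightarrow> nat \<Rightarrow> (nat \<times> nat \<Rightarrow> real) \<Rightarrow> real" where
  "noise \<sigma> m t g j Y = cusum t g j (\<lambda>ij. (Y ij - m ij) / \<sigma>)"

lemma cusum_eq_noise:
  assumes "\<sigma> \<noteq> 0"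
  shows "cusum t g j Y = \<sigma> * noise \<sigma> m t g j Y + cusum t g j m"
  using assms
  by (simp add: noise_def cusum_def right_diff_distrib sum_divide_distrib[symmetric]
      diff_divide_distrib sum_subtractf)

text \<open>Turns the two partial sums of the CUSUM into a single weighted sum of independent
  terms.\<close>

definition cusum_weight :: "nat \<Rightarrow> nat \<Rightarrow> nat \<Rightarrow> real" where
  "cusum_weight t g i = (if i \<le> t - g then sqrt (real g / (real t * (real t - real g)))
     else - sqrt ((real t - real g) / (real t * real g)))"

lemma sum_split_at:
  fixes f :: "nat \<Rightarrow> real"
  assumes "g < t"
  shows "(\<Sum>i=1..t. f i) = (\<Sum>i=1..t-g. f i) + (\<Sum>i=t-g+1..t. f i)"
  by (subst sum.union_disjoint[symmetric]) (use assms in \<open>auto intro!: sum.cong\<close>)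

lemma cusum_eq_sum_weight:
  assumes "g < t"
  shows "cusum t g j Y = (\<Sum>i=1..t. cusum_weight t g i * Y (i, j))"
  unfolding sum_split_at[OF assms] cusum_def
  by (simp add: cusum_weight_def sum_distrib_left sum_negf[symmetric])

text \<open>The two segments contribute g/t and (t - g)/t. Unit norm is what gives the noise
  variance one.\<close>

lemma sum_cusum_weight_sq:
  assumes "1 \<le> g" "g < t"
  shows "(\<Sum>i=1..t. (cusum_weight t g i)\<^sup>2) = 1"
proof -
  have "(\<Sum>i=1..t. (cusum_weight t g i)\<^sup>2)
      = real (t - g) * (real g / (real t * (real t - real g)))
        + real g * ((real t - real g) / (real t * real g))"
    unfolding sum_split_at[OF assms(2)] using assms by (simp add: cusum_weight_def)
  also have "\<dots> = 1"
    using assms by (simp add: of_nat_diff field_simps)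
  finally show ?thesis .
qed

text \<open>A sum of independent centred normals whose variances are the squared weights, adding up
  to one.\<close>

lemma distributed_noise:
  assumes "0 < \<sigma>" "1 \<le> g" "g < t"
  shows "distributed (Pmodel \<sigma> \<mu>1 \<mu>2 \<tau>) lborel (noise \<sigma> (obs_mean \<mu>1 \<mu>2 \<tau>) t g j) std_normal_density"
proof -
  interpret P: prob_space "Pmodel \<sigma> \<mu>1 \<mu>2 \<tau>" by (rule prob_space_Pmodel) fact
  let ?m = "obs_mean \<mu>1 \<mu>2 \<tau>" and ?w = "cusum_weight t g"
  have w: "?w i \<noteq> 0" for i using assms by (simp add: cusum_weight_def)
  define X where "X i Y = ?w i * ((Y (i, j) - ?m (i, j)) / \<sigma>)" for i and Y :: "nat \<times> nat \<Rightarrow> real"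
  have "P.indep_vars (\<lambda>_. borel) (\<lambda>i Y. Y (i, j)) {1..t}"
  proof -
    \<comment> \<open>For fixed j the singletons {(i, j)} are disjoint blocks, so the independent
      family can be re-indexed by time alone.\<close>
    have "P.indep_vars (\<lambda>i. PiM {(i, j)} (\<lambda>_. borel)) (\<lambda>i Y. restrict (\<lambda>ij. Y ij) {(i, j)}) {1..t}"
      by (rule P.indep_vars_restrict[OF indep_vars_Pmodel])
         (use assms in \<open>auto simp: disjoint_family_on_def\<close>)
    then have "P.indep_vars (\<lambda>_. borel) (\<lambda>i Y. restrict (\<lambda>ij. Y ij) {(i, j)} (i, j)) {1..t}"
      by (rule P.indep_vars_compose2) simp
    then show ?thesis by simp
  qed
  then have ind: "P.indep_vars (\<lambda>_. borel) X {1..t}"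
    unfolding X_def by (rule P.indep_vars_compose2) auto
  have dist: "distributed (Pmodel \<sigma> \<mu>1 \<mu>2 \<tau>) lborel (X i) (normal_density 0 \<bar>?w i\<bar>)" for i
  proof -
    let ?b = "?w i / \<sigma>"
    have eqs: "- ?b * ?m (i, j) + ?b * ?m (i, j) = 0" "\<bar>?b\<bar> * \<sigma> = \<bar>?w i\<bar>"
      using assms by (simp_all add: abs_divide)
    have "distributed (Pmodel \<sigma> \<mu>1 \<mu>2 \<tau>) lborel (\<lambda>Y. - ?b * ?m (i, j) + ?b * Y (i, j))
        (normal_density (- ?b * ?m (i, j) + ?b * ?m (i, j)) (\<bar>?b\<bar> * \<sigma>))"
      by (rule P.normal_density_affine[OF distributed_Pmodel]) (use assms w in auto)
    note this[unfolded eqs]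
    moreover have "X i = (\<lambda>Y. - ?b * ?m (i, j) + ?b * Y (i, j))"
      by (auto simp: X_def fun_eq_iff right_diff_distrib diff_divide_distrib)
    ultimately show ?thesis by simp
  qed
  have "distributed (Pmodel \<sigma> \<mu>1 \<mu>2 \<tau>) lborel (\<lambda>Y. \<Sum>i\<in>{1..t}. X i Y)
      (normal_density (\<Sum>i\<in>{1..t}. 0) (sqrt (\<Sum>i\<in>{1..t}. \<bar>?w i\<bar>\<^sup>2)))"
    by (rule P.sum_indep_normal[OF _ _ ind _ dist]) (use assms w in auto)
  moreover have "(\<lambda>Y. \<Sum>i\<in>{1..t}. X i Y) = noise \<sigma> ?m t g j"
    by (auto simp: noise_def X_def cusum_eq_sum_weight[OF assms(3)])
  ultimately show ?thesis using sum_cusum_weight_sq[OF assms(2,3)] by simp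
qed

text \<open>Entry j reads only the column \<open>K j\<close> of the observations, and distinct
  columns are disjoint blocks of independent coordinates.\<close>

lemma indep_vars_noise:
  assumes "0 < \<sigma>" "g < t"
  shows "prob_space.indep_vars (Pmodel \<sigma> \<mu>1 \<mu>2 \<tau>) (\<lambda>_. borel) (noise \<sigma> m t g) J"
proof -
  interpret P: prob_space "Pmodel \<sigma> \<mu>1 \<mu>2 \<tau>" by (rule prob_space_Pmodel) fact
  define K where "K j = (\<lambda>i. (i, j)) ` {1..t}" for j :: nat
  have "P.indep_vars (\<lambda>j. PiM (K j) (\<lambda>_. borel)) (\<lambda>j Y. restrict (\<lambda>ij. Y ij) (K j)) J"
    by (rule P.indep_vars_restrict[OF indep_vars_Pmodel])
       (use assms in \<open>auto simp: K_def disjoint_family_on_def\<close>)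
  then have "P.indep_vars (\<lambda>_. borel)
      (\<lambda>j Y. (\<Sum>i=1..t. cusum_weight t g i * ((restrict (\<lambda>ij. Y ij) (K j) (i, j) - m (i, j)) / \<sigma>))) J"
  proof (rule P.indep_vars_compose2)
    fix j
    have [measurable]: "(\<lambda>Y. Y (i, j)) \<in> borel_measurable (PiM (K j) (\<lambda>_. borel))"
      if "i \<in> {1..t}" for i
      by (rule measurable_component_singleton) (use that in \<open>auto simp: K_def\<close>)
    show "(\<lambda>Y. \<Sum>i=1..t. cusum_weight t g i * ((Y (i, j) - m (i, j)) / \<sigma>))
        \<in> borel_measurable (PiM (K j) (\<lambda>_. borel))"
      by (intro borel_measurable_sum borel_measurable_times borel_measurable_divide
          borel_measurable_diff borel_measurable_const) measurable
  qed
  moreover have "(\<Sum>i=1..t. cusum_weight t g i * ((restrict (\<lambda>ij. Y ij) (K j) (i, j) - m (i, j)) / \<sigma>))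
      = noise \<sigma> m t g j Y" for j Y
    unfolding noise_def cusum_eq_sum_weight[OF assms(2)]
    by (intro sum.cong) (auto simp: K_def)
  ultimately show ?thesis by simp
qed

section \<open>The mean of the CUSUM with and without a change\<close>

lemma cusum_scale_balance:
  fixes g t u :: real
  assumes "0 < g" "0 < t" "0 < u"
  shows "sqrt (u / (t * g)) * g = sqrt (g / (t * u)) * u"
proof (rule power2_eq_imp_eq)
  \<comment> \<open>Both squares equal ug/t.\<close>
  show "(sqrt (u / (t * g)) * g)\<^sup>2 = (sqrt (g / (t * u)) * u)\<^sup>2"
    using assms by (simp add: power_mult_distrib) (simp add: field_simps power2_eq_square)
qed (use assms in auto)

lemma cusum_obs_mean_infinity:
  assumes "1 \<le> g" "g < t"
  shows "cusum t g j (obs_mean \<mu>1 \<mu>2 \<infinity>) = 0"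
  using assms cusum_scale_balance[of g t "real t - real g"]
  by (simp add: cusum_def obs_mean_def of_nat_diff mult.assoc[symmetric])

text \<open>The condition \<open>\<tau> + g \<le> t\<close> puts the last window after the change.
  Constant means cancel by the balance of the two scales, so only the \<tau> pre-change observations
  contribute, each by the mean difference.\<close>

lemma cusum_obs_mean:
  assumes "1 \<le> g" "\<tau> + g \<le> t" "1 \<le> \<tau>"
  shows "cusum t g j (obs_mean \<mu>1 \<mu>2 (enat \<tau>))
    = sqrt (real g / (real t * (real t - real g))) * real \<tau> * (\<mu>1 j - \<mu>2 j)"
proof -
  define c where "c = sqrt (real g / (real t * (real t - real g)))"
  have c: "sqrt ((real t - real g) / (real t * real g)) * real g = c * (real t - real g)"
    unfolding c_def using assms by (intro cusum_scale_balance) auto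
  have "(\<Sum>i=1..t-g. obs_mean \<mu>1 \<mu>2 (enat \<tau>) (i, j))
      = (\<Sum>i=1..\<tau>. \<mu>1 j) + (\<Sum>i=\<tau>+1..t-g. \<mu>2 j)"
    using sum_split_at[of "t - g - \<tau>" "t - g" "\<lambda>i. obs_mean \<mu>1 \<mu>2 (enat \<tau>) (i, j)"] assms
    by (simp add: obs_mean_def)
  also have "\<dots> = real \<tau> * \<mu>1 j + (real t - real g - real \<tau>) * \<mu>2 j"
    using assms by (simp add: of_nat_diff)
  finally have 1: "(\<Sum>i=1..t-g. obs_mean \<mu>1 \<mu>2 (enat \<tau>) (i, j))
      = real \<tau> * \<mu>1 j + (real t - real g - real \<tau>) * \<mu>2 j" .
  have 2: "(\<Sum>i=t-g+1..t. obs_mean \<mu>1 \<mu>2 (enat \<tau>) (i, j)) = real g * \<mu>2 j"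
  proof -
    have "(\<Sum>i=t-g+1..t. obs_mean \<mu>1 \<mu>2 (enat \<tau>) (i, j)) = (\<Sum>i=t-g+1..t. \<mu>2 j)"
      by (intro sum.cong) (use assms in \<open>auto simp: obs_mean_def\<close>)
    then show ?thesis using assms by simp
  qed
  have "cusum t g j (obs_mean \<mu>1 \<mu>2 (enat \<tau>))
      = c * (real \<tau> * \<mu>1 j + (real t - real g - real \<tau>) * \<mu>2 j) - c * (real t - real g) * \<mu>2 j"
    unfolding cusum_def 1 2 c[symmetric] by (simp add: c_def)
  then show ?thesis by (simp add: c_def algebra_simps)
qed

section \<open>Truncated centred squares and their exponential moments\<close>

definition centred :: "real \<Rightarrow> real \<Rightarrow> real" where
  "centred a x = (x\<^sup>2 - nu a) * indicator {x. a < \<bar>x\<bar>} x"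

lemma borel_measurable_centred[measurable]: "centred a \<in> borel_measurable borel"
  unfolding centred_def by measurable

lemma Astat_eq_centred:
  assumes "0 < \<sigma>"
  shows "Astat p \<sigma> t s g Y = (\<Sum>j<p. centred (thr p s t) (cusum t g j Y / \<sigma>))"
  unfolding Astat_def centred_def using assms
  by (intro sum.cong) (auto simp: power_divide abs_divide indicator_def)

text \<open>On the tail 0 \<le> nu(a) \<le> a^2 + 2 \<le> x^2 + 2, so the value lies between -2 and
  x^2.\<close>

lemma centred_abs_le:
  assumes "0 \<le> a"
  shows "\<bar>centred a x\<bar> \<le> x\<^sup>2 + 2"
proof (cases "a < \<bar>x\<bar>")
  case True
  then have "a\<^sup>2 \<le> x\<^sup>2" using assms by (simp add: abs_le_square_iff[symmetric])
  moreover have "0 \<le> nu a" using nu_ge[OF assms] order_trans[OF zero_le_power2] by blast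
  ultimately show ?thesis using nu_ge[OF assms] nu_le[OF assms] True
    by (auto simp: centred_def abs_le_iff) (use zero_le_power2[of x] in linarith)
qed (simp add: centred_def)

text \<open>Below the threshold x^2 \<le> a^2 \<le> nu(a), so truncation only replaces a nonpositive
  number by zero.\<close>

lemma centred_ge:
  assumes "0 \<le> a"
  shows "x\<^sup>2 - nu a \<le> centred a x"
proof (cases "a < \<bar>x\<bar>")
  case False
  then have "x\<^sup>2 \<le> a\<^sup>2" using assms by (simp add: abs_le_square_iff[symmetric])
  then show ?thesis using False nu_ge[OF assms] by (simp add: centred_def)
qed (simp add: centred_def)

lemma nn_integral_exp_centred_le:
  assumes "0 \<le> a" "\<bar>\<eta>\<bar> \<le> 1 / 16"
  shows "(\<integral>\<^sup>+x. ennreal (std_normal_density x) * ennreal (exp (\<eta> * centred a x)) \<partial>lborel)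
          \<le> ennreal (exp (2048 * \<eta>\<^sup>2 * exp (- a\<^sup>2 / 4)))"
proof (rule nn_integral_std_normal_exp_le)
  show "(LINT x|lborel. std_normal_density x * centred a x) = 0"
    unfolding centred_def by (rule integral_std_normal_centred) fact
qed (use assms centred_abs_le in \<open>auto simp: centred_def\<close>)

lemma nn_integral_exp_square_centred_le:
  assumes "\<bar>\<eta>\<bar> \<le> 1 / 16"
  shows "(\<integral>\<^sup>+x. ennreal (std_normal_density x) * ennreal (exp (\<eta> * (x\<^sup>2 - 1))) \<partial>lborel)
          \<le> ennreal (exp (2048 * \<eta>\<^sup>2))"
  using nn_integral_std_normal_exp_le[of 0 "\<lambda>x. x\<^sup>2 - 1" \<eta>] integral_std_normal_square_centred assms
  by (simp add: abs_le_iff add_increasing)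

text \<open>The exact value is 2; the bound exp(1) has the shape that the Chernoff lemma
  expects.\<close>

lemma nn_integral_exp_square_le:
  "(\<integral>\<^sup>+x. ennreal (std_normal_density x) * ennreal (exp (3 / 8 * x\<^sup>2)) \<partial>lborel) \<le> ennreal (exp 1)"
proof -
  have "(\<integral>\<^sup>+x. ennreal (std_normal_density x) * ennreal (exp (3 / 8 * x\<^sup>2)) \<partial>lborel)
      = (\<integral>\<^sup>+x. ennreal (std_normal_density x * exp (3 * x\<^sup>2 / 8)) \<partial>lborel)"
    by (simp add: ennreal_mult')
  also have "\<dots> = ennreal 2"
    using has_bochner_integral_std_normal_exp_square
    by (auto simp: has_bochner_integral_iff nn_integral_eq_integral)
  also have "\<dots> \<le> ennreal (exp 1)"
    using exp_ge_add_one_self[of 1] by (intro ennreal_leI) simp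
  finally show ?thesis .
qed

lemma nn_integral_exp_linear:
  "(\<integral>\<^sup>+x. ennreal (std_normal_density x) * ennreal (exp (c * x)) \<partial>lborel) = ennreal (exp (c\<^sup>2 / 2))"
proof -
  have "std_normal_density x * exp (c * x) = exp (c\<^sup>2 / 2) * normal_density c 1 x" for x
  proof -
    have "exp (- (x\<^sup>2 / 2)) * exp (c * x) = exp (c\<^sup>2 / 2) * exp (- ((x - c)\<^sup>2 / 2))"
      unfolding mult_exp_exp by (simp add: power2_eq_square field_simps)
    then show ?thesis by (simp add: normal_density_def)
  qed
  then have "(\<integral>\<^sup>+x. ennreal (std_normal_density x) * ennreal (exp (c * x)) \<partial>lborel)
      = (\<integral>\<^sup>+x. ennreal (exp (c\<^sup>2 / 2) * normal_density c 1 x) \<partial>lborel)"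
    by (simp flip: ennreal_mult')
  also have "\<dots> = ennreal (LINT x|lborel. exp (c\<^sup>2 / 2) * normal_density c 1 x)"
    by (intro nn_integral_eq_integral) auto
  finally show ?thesis by (simp add: integral_normal_density)
qed

section \<open>The threshold and the logarithmic ratio in the sparse range\<close>

lemma ln_ratio_ge_1:
  fixes s p L :: real
  assumes "0 < s" "s \<le> sqrt (p * L)"
  shows "1 \<le> ln (exp 1 * p * L / s\<^sup>2)"
proof -
  have "0 < p * L" using assms by (metis less_le_trans real_sqrt_gt_0_iff)
  then have "s\<^sup>2 \<le> p * L" using power_mono[OF assms(2), of 2] assms(1) by simp
  then have "exp 1 * s\<^sup>2 \<le> exp 1 * (p * L)" by simp
  then have "exp 1 \<le> exp 1 * p * L / s\<^sup>2"
    using assms(1) by (simp add: pos_le_divide_eq mult.assoc)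
  from ln_mono[OF this] show ?thesis by simp
qed

context
  fixes p s t :: nat
  assumes pos: "1 \<le> s" "1 \<le> p" "2 \<le> t" and sparse: "real s \<le> sqrt (real p * ln (real t))"
begin

lemma thr_power2: "(thr p s t)\<^sup>2 = 4 * ln (exp 1 * real p * ln (real t) / (real s)\<^sup>2)"
proof -
  define r where "r = ln (exp 1 * real p * ln (real t) / (real s)\<^sup>2)"
  have "1 \<le> r" unfolding r_def using pos sparse by (intro ln_ratio_ge_1) auto
  moreover have "thr p s t = sqrt (4 * r)"
    using sparse by (simp add: thr_def r_def divide_inverse mult_ac)
  ultimately show ?thesis unfolding r_def[symmetric] by simp
qed

text \<open>The factor 4 in the squared threshold cancels the 1/4 of the tail bound.\<close>

lemma exp_thr: "exp (- (thr p s t)\<^sup>2 / 4) = (real s)\<^sup>2 / (exp 1 * real p * ln (real t))"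
  unfolding thr_power2 using pos by (simp add: exp_minus)

end

lemma thr_eq_0: "\<not> real s \<le> sqrt (real p * ln (real t)) \<Longrightarrow> thr p s t = 0"
  by (simp add: thr_def)

lemma thr_nonneg:
  assumes "1 \<le> s"
  shows "0 \<le> thr p s t"
proof (cases "real s \<le> sqrt (real p * ln (real t))")
  case True
  define r where "r = ln (exp 1 * real p * ln (real t) / (real s)\<^sup>2)"
  have "1 \<le> r" unfolding r_def using assms True by (intro ln_ratio_ge_1) auto
  moreover have "thr p s t = sqrt (4 * r)"
    using True by (simp add: thr_def r_def divide_inverse mult_ac)
  ultimately show ?thesis by simp
qed (simp add: thr_eq_0)

section \<open>Grids and the stopping time\<close>

lemma borel_measurable_Pmodel_coord[measurable]:
  "(\<lambda>Y. Y ij) \<in> borel_measurable (Pmodel \<sigma> \<mu>1 \<mu>2 \<tau>)"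
proof -
  have "(\<lambda>Y. Y ij) \<in> measurable (Pmodel \<sigma> \<mu>1 \<mu>2 \<tau>)
      ((\<lambda>(i, j). density lborel (normal_density (if enat i \<le> \<tau> then \<mu>1 j else \<mu>2 j) \<sigma>)) ij)"
    unfolding Pmodel_def by (rule measurable_component_singleton) simp
  then show ?thesis by (cases ij) (simp cong: measurable_cong_sets)
qed

lemma borel_measurable_cusum[measurable]:
  "cusum t g j \<in> borel_measurable (Pmodel \<sigma> \<mu>1 \<mu>2 \<tau>)"
  unfolding cusum_def by measurable

lemma borel_measurable_noise[measurable]:
  "noise \<sigma> m t g j \<in> borel_measurable (Pmodel \<sigma> \<mu>1 \<mu>2 \<tau>)"
  unfolding noise_def cusum_def by measurable

lemma borel_measurable_Astat[measurable]:
  "Astat p \<sigma>' t s g \<in> borel_measurable (Pmodel \<sigma> \<mu>1 \<mu>2 \<tau>)"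
  unfolding Astat_def by measurable

text \<open>Also right for x < 1: the floor is then negative and no natural i qualifies, which
  matches an empty union.\<close>

lemma log2_floor_iff:
  assumes "0 < x"
  shows "int i \<le> \<lfloor>log 2 x\<rfloor> \<longleftrightarrow> 2 ^ i \<le> x"
proof -
  have "int i \<le> \<lfloor>log 2 x\<rfloor> \<longleftrightarrow> real i \<le> log 2 x" by (simp add: le_floor_iff)
  also have "\<dots> \<longleftrightarrow> 2 ^ i \<le> x" using assms by (simp add: le_log_iff powr_realpow)
  finally show ?thesis .
qed

section \<open>The sparsity grid and the window grid\<close>

lemma Sgrid_eq:
  assumes "1 \<le> p" "2 \<le> t"
  shows "Sgrid p t = {2 ^ i | i. 2 ^ i \<le> sqrt (real p * ln (real t)) \<and> 2 ^ i \<le> real p} \<union> {p}"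
proof -
  have "0 < min (sqrt (real p * ln (real t))) (real p)" using assms by simp
  from log2_floor_iff[OF this] show ?thesis by (auto simp: Sgrid_def)
qed

lemma Sgrid_bounds:
  assumes "1 \<le> p" "2 \<le> t" "s \<in> Sgrid p t"
  shows "1 \<le> s" "s \<le> p"
proof -
  consider i where "s = 2 ^ i" "real (2 ^ i) \<le> real p" | "s = p"
    using assms unfolding Sgrid_eq[OF assms(1,2)] by auto
  then have "1 \<le> s \<and> s \<le> p"
  proof cases
    case (1 i)
    then show ?thesis by (simp only: of_nat_le_iff) simp
  qed (use assms in auto)
  then show "1 \<le> s" "s \<le> p" by auto
qed

lemma finite_Sgrid:
  assumes "1 \<le> p" "2 \<le> t"
  shows "finite (Sgrid p t)"
proof (rule finite_subset)
  show "Sgrid p t \<subseteq> {..p}" using Sgrid_bounds(2)[OF assms] by blast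
qed simp

lemma Ggrid_eq:
  assumes "2 \<le> t"
  shows "Ggrid t = {1} \<union> {gL t j | j. 1 \<le> j \<and> 2 ^ (j - 1) \<le> (real t - 1) / 3}
     \<union> {gR t j | j. 1 \<le> j \<and> 2 ^ (j + 1) \<le> real t - 1}"
proof -
  have R: "int j \<le> \<lfloor>log 2 (real t - 1)\<rfloor> - 1 \<longleftrightarrow> 2 ^ (j + 1) \<le> real t - 1" for j
  proof -
    have "int j \<le> \<lfloor>log 2 (real t - 1)\<rfloor> - 1 \<longleftrightarrow> int (j + 1) \<le> \<lfloor>log 2 (real t - 1)\<rfloor>"
      by linarith
    then show ?thesis using assms by (subst (asm) log2_floor_iff) simp_all
  qed
  \<comment> \<open>The index shift of one becomes the exponent j - 1; \<open>1 \<le> j\<close>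
    keeps the natural subtraction exact.\<close>
  have L: "int j \<le> \<lfloor>log 2 ((real t - 1) / 3)\<rfloor> + 1 \<longleftrightarrow> 2 ^ (j - 1) \<le> (real t - 1) / 3"
    if "1 \<le> j" for j
  proof -
    have "int j \<le> \<lfloor>log 2 ((real t - 1) / 3)\<rfloor> + 1 \<longleftrightarrow> int (j - 1) \<le> \<lfloor>log 2 ((real t - 1) / 3)\<rfloor>"
      using that by linarith
    then show ?thesis using assms by (subst (asm) log2_floor_iff) simp_all
  qed
  show ?thesis unfolding Ggrid_def R by (auto simp only: L)
qed

text \<open>The residue is below 2^(j-1), half of the leading power 2^j.\<close>

lemma gL_bounds:
  assumes "1 \<le> j"
  shows "2 ^ j \<le> gL t j" "gL t j < 3 * 2 ^ (j - 1)"
proof -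
  have "(t - 1) mod 2 ^ (j - 1) < 2 ^ (j - 1)" by simp
  moreover have "(2::nat) ^ j = 2 * 2 ^ (j - 1)" using assms by (cases j) auto
  ultimately show "2 ^ j \<le> gL t j" "gL t j < 3 * 2 ^ (j - 1)" by (auto simp: gL_def)
qed

text \<open>Left points stay below 3 * 2^(j-1), right points below 4 * 2^(j-1) = 2^(j+1); both
  numbers are at most t - 1 by the range of j.\<close>

lemma Ggrid_bounds:
  assumes "2 \<le> t" "g \<in> Ggrid t"
  shows "1 \<le> g" "g < t"
proof -
  consider "g = 1" | j where "g = gL t j" "1 \<le> j" "2 ^ (j - 1) \<le> (real t - 1) / 3"
    | j where "g = gR t j" "1 \<le> j" "2 ^ (j + 1) \<le> real t - 1"
    using assms unfolding Ggrid_eq[OF assms(1)] by blast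
  then have "1 \<le> g \<and> g < t"
  proof cases
    case (2 j)
    then have "real (3 * 2 ^ (j - 1) + 1) \<le> real t" by simp
    then have "3 * 2 ^ (j - 1) + 1 \<le> t" by (simp only: of_nat_le_iff)
    moreover have "1 \<le> (2::nat) ^ j" by simp
    ultimately show ?thesis using gL_bounds[OF 2(2), of t] 2(1) by linarith
  next
    case (3 j)
    then have "real (2 ^ (j + 1) + 1) \<le> real t" by simp
    then have "2 ^ (j + 1) + 1 \<le> t" by (simp only: of_nat_le_iff)
    moreover have "(2::nat) ^ (j + 1) = 4 * 2 ^ (j - 1)" using 3(2) by (cases j) auto
    moreover have "1 \<le> (2::nat) ^ j" by simp
    ultimately show ?thesis using gL_bounds[OF 3(2), of t] 3(1) unfolding gR_def by linarith
  qed (use assms in auto)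
  then show "1 \<le> g" "g < t" by auto
qed

lemma Ggrid_subset:
  assumes "2 \<le> t"
  shows "Ggrid t \<subseteq> {..<t}"
  using Ggrid_bounds(2)[OF assms] by blast

lemma finite_Ggrid: "2 \<le> t \<Longrightarrow> finite (Ggrid t)"
  by (rule finite_subset[OF Ggrid_subset]) simp_all

text \<open>A crude count that suffices: the power decay in t of the false alarm bound absorbs a
  factor t.\<close>

lemma card_Ggrid_le: "2 \<le> t \<Longrightarrow> card (Ggrid t) \<le> t"
  using card_mono[OF _ Ggrid_subset] by simp

text \<open>Supplies a window inside the d post-change observations that is longer than a quarter of
  them. The point 1 serves d < 4, a left point serves larger d.\<close>

lemma Ggrid_approx:
  assumes "1 \<le> d" "2 * d \<le> t"
  obtains g where "g \<in> Ggrid t" "g \<le> d" "d < 4 * g"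
proof (cases "d < 4")
  case True
  then show ?thesis using that[of 1] assms by (simp add: Ggrid_def)
next
  case False
  \<comment> \<open>One scale below d: a left point can reach almost 3/2 of 2^j, which is still
    below 2 * 2^j \<le> d, while 4 * 2^j > d.\<close>
  define j where "j = floor_log d - 1"
  have f2: "2 ^ floor_log d \<le> d" "d < 2 * 2 ^ floor_log d"
    using floor_log_exp2_le[of d] floor_log_exp2_gt[of d] assms by auto
  have "floor_log 4 \<le> floor_log d" by (rule floor_log_mono[THEN monoD]) (use False in simp)
  moreover have "floor_log 4 = 2" by (simp add: floor_log.simps)
  ultimately have j: "1 \<le> j" "floor_log d = Suc j" by (auto simp: j_def)
  have f: "2 * 2 ^ j \<le> d" "d < 4 * 2 ^ j" using f2 unfolding j by auto
  have jj: "(2::nat) ^ j = 2 * 2 ^ (j - 1)" using j by (cases j) auto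
  have t: "2 \<le> t" using assms by simp
  have "8 * 2 ^ (j - 1) \<le> t" using f assms jj by linarith
  then have "3 * 2 ^ (j - 1) + 1 \<le> t"
    using one_le_power[of "2::nat" "j - 1"] by linarith
  then have "real (3 * 2 ^ (j - 1) + 1) \<le> real t" by (simp only: of_nat_le_iff)
  then have "gL t j \<in> Ggrid t" unfolding Ggrid_eq[OF t] using j(1) by fastforce
  moreover have "gL t j \<le> d" "d < 4 * gL t j"
    using gL_bounds[OF j(1), of t] f jj by linarith+
  ultimately show ?thesis by (rule that)
qed

section \<open>The stopping time as the first alarm\<close>

lemma zfun_pos:
  assumes "1 \<le> p" "2 \<le> t"
  shows "0 < zfun s p t"
  using assms by (simp add: zfun_def less_max_iff_disj)

text \<open>The test at time t freed of maxima and quotients, hence a finite union of events on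
  single statistics.\<close>

definition alarm :: "nat \<Rightarrow> real \<Rightarrow> real \<Rightarrow> nat \<Rightarrow> (nat \<times> nat \<Rightarrow> real) \<Rightarrow> bool" where
  "alarm p \<sigma> lam t Y \<longleftrightarrow>
    (\<exists>g\<in>Ggrid t. \<exists>s\<in>Sgrid p t. lam * zfun (real s) p (real t) < Astat p \<sigma> t s g Y)"

lemma Max_Tstat_eq_1_iff:
  assumes "1 \<le> p" "2 \<le> t" "0 < lam"
  shows "Max ((\<lambda>g. Tstat p \<sigma> lam t g Y) ` Ggrid t) = 1 \<longleftrightarrow> alarm p \<sigma> lam t Y"
proof -
  have T: "Tstat p \<sigma> lam t g Y = 1 \<longleftrightarrow>
      (\<exists>s\<in>Sgrid p t. lam * zfun (real s) p (real t) < Astat p \<sigma> t s g Y)" for g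
  proof -
    have ne: "Sgrid p t \<noteq> {}" by (auto simp: Sgrid_def)
    have "1 < Astat p \<sigma> t s g Y / (lam * zfun (real s) p (real t)) \<longleftrightarrow>
      lam * zfun (real s) p (real t) < Astat p \<sigma> t s g Y" for s
      using zfun_pos[of p "real t" "real s"] assms by (simp add: less_divide_eq_1_pos)
    then show ?thesis
      unfolding Tstat_def using finite_Sgrid[OF assms(1,2)] ne by (auto simp: Max_gr_iff)
  qed
  have T01: "Tstat p \<sigma> lam t g Y \<le> 1" for g by (simp add: Tstat_def)
  have ne: "Ggrid t \<noteq> {}" by (auto simp: Ggrid_def)
  have "Max ((\<lambda>g. Tstat p \<sigma> lam t g Y) ` Ggrid t) = 1 \<longleftrightarrow> (\<exists>g\<in>Ggrid t. Tstat p \<sigma> lam t g Y = 1)"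
  proof (subst Max_eq_iff)
    show "(1 \<in> (\<lambda>g. Tstat p \<sigma> lam t g Y) ` Ggrid t
        \<and> (\<forall>a\<in>(\<lambda>g. Tstat p \<sigma> lam t g Y) ` Ggrid t. a \<le> 1))
      \<longleftrightarrow> (\<exists>g\<in>Ggrid t. Tstat p \<sigma> lam t g Y = 1)"
      using T01 by (metis (no_types, lifting) image_iff)
  qed (use finite_Ggrid[OF assms(2)] ne in auto)
  then show ?thesis by (simp only: T alarm_def)
qed

lemma tauhat_le_iff:
  assumes "1 \<le> p" "0 < lam"
  shows "tauhat p \<sigma> lam Y \<le> enat n \<longleftrightarrow> (\<exists>t\<in>{2..n}. alarm p \<sigma> lam t Y)"
proof -
  let ?A = "{enat t | t. t \<ge> 2 \<and> Max ((\<lambda>g. Tstat p \<sigma> lam t g Y) ` Ggrid t) = 1}"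
  have e: "2 \<le> t \<and> Max ((\<lambda>g. Tstat p \<sigma> lam t g Y) ` Ggrid t) = 1
      \<longleftrightarrow> 2 \<le> t \<and> alarm p \<sigma> lam t Y" for t
    using Max_Tstat_eq_1_iff[OF assms(1) _ assms(2), of t] by blast
  have A: "?A = enat ` {t. 2 \<le> t \<and> alarm p \<sigma> lam t Y}"
    unfolding e by blast
  have "Inf ?A \<le> enat n \<longleftrightarrow> (\<exists>x\<in>?A. x \<le> enat n)"
  proof
    assume "Inf ?A \<le> enat n"
    \<comment> \<open>The infimum of the empty set is \<infinity>, which exceeds every
      \<open>enat n\<close>.\<close>
    moreover from this have "?A \<noteq> {}" by (auto simp only: Inf_empty top_enat_def)
    then obtain x where "x \<in> ?A" by (meson ex_in_conv)
    \<comment> \<open>A nonempty set of extended naturals attains its infimum by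
      well-ordering.\<close>
    with \<open>?A \<noteq> {}\<close> have "Inf ?A \<in> ?A"
      unfolding Inf_enat_def by (simp only: if_False) (rule LeastI)
    ultimately show "\<exists>x\<in>?A. x \<le> enat n" by (rule bexI)
  next
    assume "\<exists>x\<in>?A. x \<le> enat n"
    then obtain x where "x \<in> ?A" "x \<le> enat n" by (rule bexE)
    then show "Inf ?A \<le> enat n" by (rule Inf_lower2)
  qed
  then show ?thesis unfolding tauhat_def A by auto
qed

lemma tauhat_finite_iff:
  assumes "1 \<le> p" "0 < lam"
  shows "tauhat p \<sigma> lam Y < \<infinity> \<longleftrightarrow> (\<exists>t\<ge>2. alarm p \<sigma> lam t Y)"
proof -
  have "tauhat p \<sigma> lam Y < \<infinity> \<longleftrightarrow> (\<exists>n. tauhat p \<sigma> lam Y \<le> enat n)"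
    by (cases "tauhat p \<sigma> lam Y") auto
  also have "\<dots> \<longleftrightarrow> (\<exists>t\<ge>2. alarm p \<sigma> lam t Y)"
    unfolding tauhat_le_iff[OF assms] by (meson atLeastAtMost_iff order_refl)
  finally show ?thesis .
qed

section \<open>False alarms\<close>

text \<open>Without a change the CUSUM entries are pure noise, so the Chernoff bound applies to the
  sum of centred squares at rate \<eta>.\<close>

lemma Astat_upper_tail:
  assumes "0 < \<sigma>" "1 \<le> g" "g < t" "1 \<le> s" "0 \<le> \<eta>" "\<eta> \<le> 1 / 16"
  shows "measure (Pmodel \<sigma> \<mu>1 \<mu>2 \<infinity>) {Y \<in> space (Pmodel \<sigma> \<mu>1 \<mu>2 \<infinity>). x < Astat p \<sigma> t s g Y}
    \<le> exp (2048 * \<eta>\<^sup>2 * real p * exp (- (thr p s t)\<^sup>2 / 4) - \<eta> * x)"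
proof -
  let ?P = "Pmodel \<sigma> \<mu>1 \<mu>2 \<infinity>" and ?m = "obs_mean \<mu>1 \<mu>2 \<infinity>" and ?a = "thr p s t"
  interpret P: prob_space ?P by (rule prob_space_Pmodel) fact
  have a: "0 \<le> ?a" by (rule thr_nonneg) fact
  have "Astat p \<sigma> t s g Y = (\<Sum>j<p. centred ?a (noise \<sigma> ?m t g j Y))" for Y
    unfolding Astat_eq_centred[OF assms(1)]
    using assms cusum_eq_noise[of \<sigma> t g _ Y ?m] cusum_obs_mean_infinity[OF assms(2,3), of _ \<mu>1 \<mu>2]
    by (intro sum.cong) simp_all
  then have "P.prob {Y \<in> space ?P. x < Astat p \<sigma> t s g Y}
      \<le> P.prob {Y \<in> space ?P. \<eta> * x \<le> (\<Sum>j<p. \<eta> * centred ?a (noise \<sigma> ?m t g j Y))}"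
    using assms by (intro P.finite_measure_mono) (auto simp flip: sum_distrib_left intro!: mult_left_mono)
  also have "\<dots> \<le> exp ((\<Sum>j<p. 2048 * \<eta>\<^sup>2 * exp (- ?a\<^sup>2 / 4)) - \<eta> * x)"
    by (rule P.chernoff_std_normal[where Z = "noise \<sigma> ?m t g" and f = "\<lambda>_ x. \<eta> * centred ?a x"])
       (use assms a in \<open>auto intro!: indep_vars_noise distributed_noise
          nn_integral_exp_centred_le[unfolded minus_divide_left[symmetric]]\<close>)
  finally show ?thesis by (simp add: mult_ac)
qed

text \<open>The share of s in the union bound. In the middle range the tail bound leaves a spare
  factor s^2/(p log t), which sums geometrically over powers of two, uniformly in p; the remaining
  grid values are few and get weight one.\<close>

definition grid_weight :: "nat \<Rightarrow> nat \<Rightarrow> nat \<Rightarrow> real" where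
  "grid_weight p t s = (if ln (real t) < real s \<and> real s \<le> sqrt (real p * ln (real t))
     then (real s)\<^sup>2 / (real p * ln (real t)) else 1)"

lemma grid_weight_nonneg: "2 \<le> t \<Longrightarrow> 0 \<le> grid_weight p t s"
  by (simp add: grid_weight_def)

text \<open>In each regime the linear gain is at least (lam/16) log t and the quadratic cost at most
  2048/256 = 8 times log t, whence \<Lambda> = lam/16 - 8.\<close>

lemma false_alarm_exponent:
  fixes lam :: real
  defines "\<Lambda> \<equiv> lam / 16 - 8"
  assumes "1 \<le> p" "2 \<le> t" "1 \<le> s" "s \<le> p" and \<Lambda>: "2 \<le> \<Lambda>"
  obtains \<eta> where "0 \<le> \<eta>" "\<eta> \<le> 1 / 16"
    "exp (2048 * \<eta>\<^sup>2 * real p * exp (- (thr p s t)\<^sup>2 / 4) - \<eta> * (lam * zfun (real s) p (real t)))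
      \<le> real t powr (- \<Lambda>) * grid_weight p t s"
proof -
  define L where "L = ln (real t)"
  have L: "0 < L" "2 / 3 \<le> L"
  proof -
    have "ln 2 \<le> ln (real t)" using assms by simp
    then show "2 / 3 \<le> L" using ln2_ge_two_thirds unfolding L_def by linarith
    then show "0 < L" by simp
  qed
  have lam: "lam = 16 * \<Lambda> + 128" by (simp add: \<Lambda>_def)
  have tp: "real t powr (- \<Lambda>) = exp (- \<Lambda> * L)" using assms by (simp add: powr_def L_def)
  note Ld = L_def[symmetric]
  have p: "0 < real p" "1 \<le> real p" using assms by auto
  have s: "0 < real s" "1 \<le> real s" using assms by auto
  have e1: "2 \<le> exp (1::real)" using exp_ge_add_one_self[of 1] by simp
  show ?thesis
  proof (cases "real s \<le> sqrt (real p * L)")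
    case False
    \<comment> \<open>Dense s together with s \<le> p forces log t \<le> p, which keeps the rate
      below 1/16.\<close>
    have "sqrt (real p * L) < real p" using False assms(5) by (meson less_le_trans not_le of_nat_le_iff)
    then have "real p * L < real p * real p"
      using p by (metis abs_of_nonneg less_eq_real_def power2_eq_square real_less_rsqrt real_sqrt_abs real_sqrt_less_iff)
    then have Lp: "L \<le> real p" using p by simp
    \<comment> \<open>This rate makes both the quadratic and the linear term multiples of L.\<close>
    define \<eta> where "\<eta> = sqrt (L / real p) / 16"
    have \<eta>2: "\<eta>\<^sup>2 * real p = L / 256" using L p by (simp add: \<eta>_def power_divide)
    have r: "sqrt (L / real p) * sqrt (real p * L) = L"
      using L p by (simp add: real_sqrt_mult[symmetric])
    have z: "zfun (real s) p (real t) = sqrt (real p * L)" using False by (simp add: zfun_def L_def)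
    show ?thesis
    proof (rule that)
      show "0 \<le> \<eta>" "\<eta> \<le> 1 / 16" using L Lp p by (auto simp: \<eta>_def)
      have "2048 * \<eta>\<^sup>2 * real p * exp (- (thr p s t)\<^sup>2 / 4) - \<eta> * (lam * zfun (real s) p (real t))
          = 2048 * (\<eta>\<^sup>2 * real p) - lam / 16 * (sqrt (L / real p) * sqrt (real p * L))"
        using False by (simp add: thr_eq_0 z L_def \<eta>_def)
      also have "\<dots> = - \<Lambda> * L" unfolding \<eta>2 r lam by (simp add: algebra_simps)
      finally show "exp (2048 * \<eta>\<^sup>2 * real p * exp (- (thr p s t)\<^sup>2 / 4) - \<eta> * (lam * zfun (real s) p (real t)))
          \<le> real t powr (- \<Lambda>) * grid_weight p t s"
        using False by (simp add: tp grid_weight_def L_def)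
    qed
  next
    case True
    \<comment> \<open>Splits off the factor e, so that the ratio has logarithm 1 + l and exp(-l) is
      exactly the weight s^2/(pL).\<close>
    define l where "l = ln (real p * L / (real s)\<^sup>2)"
    have el: "ln (exp 1 * real p * L / (real s)\<^sup>2) = 1 + l"
      unfolding l_def using p s L by (simp add: ln_mult ln_div)
    have l0: "0 \<le> l" using ln_ratio_ge_1[OF s(1) True] unfolding el by simp
    have z: "zfun (real s) p (real t) = max (real s * (1 + l)) L"
      using True by (simp add: zfun_def L_def[symmetric] el)
    have a: "exp (- (thr p s t)\<^sup>2 / 4) = (real s)\<^sup>2 / (exp 1 * real p * L)"
      unfolding L_def by (rule exp_thr) (use assms True in \<open>auto simp: L_def\<close>)
    have q: "2048 * \<eta>\<^sup>2 * real p * exp (- (thr p s t)\<^sup>2 / 4) \<le> 2048 * \<eta>\<^sup>2 * ((real s)\<^sup>2 / L)" for \<eta>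
    proof -
      have "real p * exp (- (thr p s t)\<^sup>2 / 4) = (real s)\<^sup>2 / L / exp 1"
        unfolding a using p by simp
      also have "\<dots> \<le> (real s)\<^sup>2 / L"
        using divide_left_mono[of 1 "exp 1" "(real s)\<^sup>2 / L"] e1 L by simp
      finally show ?thesis unfolding mult.assoc by (intro mult_left_mono) auto
    qed
    show ?thesis
    proof (cases "real s \<le> L")
      case sL: True
      show ?thesis
      \<comment> \<open>For s \<le> L the largest admissible rate works, since s^2/L \<le>
        L.\<close>
      proof (rule that[of "1 / 16"])
        have "(real s)\<^sup>2 / L \<le> L"
          using sL L s power_mono[OF sL, of 2] by (simp add: divide_le_eq power2_eq_square)
        moreover have "lam * L \<le> lam * zfun (real s) p (real t)"
          using \<Lambda> unfolding z lam by (intro mult_left_mono) auto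
        ultimately have "2048 * (1 / 16)\<^sup>2 * real p * exp (- (thr p s t)\<^sup>2 / 4) - (1 / 16) * (lam * zfun (real s) p (real t))
          \<le> 8 * L - 1 / 16 * (lam * L)"
          using q[of "1 / 16"] by (simp add: power_divide)
        also have "\<dots> = - \<Lambda> * L" unfolding lam by (simp add: algebra_simps)
        finally show "exp (2048 * (1 / 16)\<^sup>2 * real p * exp (- (thr p s t)\<^sup>2 / 4) - (1 / 16) * (lam * zfun (real s) p (real t)))
          \<le> real t powr (- \<Lambda>) * grid_weight p t s"
          using sL by (simp add: tp grid_weight_def L_def)
      qed auto
    next
      case sL: False
      \<comment> \<open>Balances the quadratic cost s^2/L at L/256; the rate is below 1/16 because s
        > L.\<close>
      define \<eta> where "\<eta> = L / (16 * real s)"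
      show ?thesis
      proof (rule that)
        show "0 \<le> \<eta>" "\<eta> \<le> 1 / 16" using L s sL by (auto simp: \<eta>_def field_simps)
        have e: "\<eta>\<^sup>2 * ((real s)\<^sup>2 / L) = L / 256"
          using L s by (simp add: \<eta>_def power_divide power_mult_distrib power2_eq_square)
        have "2048 * \<eta>\<^sup>2 * ((real s)\<^sup>2 / L) = 8 * L"
          unfolding mult.assoc e by simp
        with q[of \<eta>] have 1: "2048 * \<eta>\<^sup>2 * real p * exp (- (thr p s t)\<^sup>2 / 4) \<le> 8 * L"
          by simp
        have "\<eta> * (lam * (real s * (1 + l))) \<le> \<eta> * (lam * zfun (real s) p (real t))"
          using \<Lambda> L s unfolding z lam \<eta>_def by (intro mult_left_mono) auto
        moreover have "\<eta> * (lam * (real s * (1 + l))) = (\<Lambda> + 8) * (L * (1 + l))"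
          using s by (simp add: \<eta>_def lam field_simps)
        moreover have "L \<le> L * (1 + l)" using L l0 by simp
        moreover have "(\<Lambda> + 8) * (L * (1 + l)) = \<Lambda> * L + \<Lambda> * L * l + 8 * (L * (1 + l))"
          by (simp add: algebra_simps)
        \<comment> \<open>This spare part of the linear term pays for the weight exp(-l).\<close>
        moreover have "l \<le> \<Lambda> * L * l"
        proof -
          have "1 \<le> \<Lambda> * L" using mult_mono[of 2 \<Lambda> "2/3" L] \<Lambda> L by simp
          from mult_right_mono[OF this l0] show ?thesis by simp
        qed
        ultimately have "2048 * \<eta>\<^sup>2 * real p * exp (- (thr p s t)\<^sup>2 / 4) - \<eta> * (lam * zfun (real s) p (real t))
            \<le> - \<Lambda> * L + - l"
          using 1 by linarith
        then have "exp (2048 * \<eta>\<^sup>2 * real p * exp (- (thr p s t)\<^sup>2 / 4) - \<eta> * (lam * zfun (real s) p (real t)))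
            \<le> exp (- \<Lambda> * L) * exp (- l)" unfolding mult_exp_exp by simp
        also have "exp (- l) = (real s)\<^sup>2 / (real p * L)"
          unfolding l_def using p s L by (simp add: exp_minus)
        finally show "exp (2048 * \<eta>\<^sup>2 * real p * exp (- (thr p s t)\<^sup>2 / 4) - \<eta> * (lam * zfun (real s) p (real t)))
          \<le> real t powr (- \<Lambda>) * grid_weight p t s"
          using sL True by (simp add: tp grid_weight_def L_def)
      qed
    qed
  qed
qed

section \<open>Summation over the sparsity grid and over time\<close>

lemma sum_power4_le:
  fixes X :: real
  assumes "finite I" "\<And>i. i \<in> I \<Longrightarrow> 4 ^ i \<le> X" "0 \<le> X"
  shows "(\<Sum>i\<in>I. (4::real) ^ i) \<le> 2 * X"
proof (cases "I = {}")
  case False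
  \<comment> \<open>A geometric sum with ratio 4 is dominated by its last term.\<close>
  have geo: "(\<Sum>i\<le>n. (4::real) ^ i) \<le> 2 * 4 ^ n" for n
  proof (induction n)
    case (Suc n)
    have "0 \<le> (4::real) ^ n" by simp
    with Suc.IH show ?case unfolding sum.atMost_Suc power_Suc by linarith
  qed simp
  have "(\<Sum>i\<in>I. (4::real) ^ i) \<le> (\<Sum>i\<le>Max I. 4 ^ i)"
    using assms(1) by (intro sum_mono2) auto
  also have "\<dots> \<le> 2 * 4 ^ Max I" by (rule geo)
  also have "\<dots> \<le> 2 * X" using assms(2)[of "Max I"] False assms(1) by simp
  finally show ?thesis .
qed (use assms in auto)

text \<open>The value p and the integers up to log t cost at most 1 + log t. The powers of two in
  the middle range have squares 4^i \<le> p log t, so their weights sum to at most 2. The bound does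
  not depend on p.\<close>

lemma sum_grid_weight_le:
  assumes "1 \<le> p" "2 \<le> t"
  shows "(\<Sum>s\<in>Sgrid p t. grid_weight p t s) \<le> 2 * real t"
proof -
  define L where "L = ln (real t)"
  have L: "0 < L" "L \<le> real t - 1" "2 \<le> real t"
    using assms ln_le_minus_one[of "real t"] by (auto simp: L_def)
  let ?S2 = "{1..nat \<lfloor>L\<rfloor>}"
  define I where "I = {i. 2 ^ i \<in> Sgrid p t \<and> L < 2 ^ i \<and> (2::real) ^ i \<le> sqrt (real p * L)}"
  have nn: "0 \<le> grid_weight p t s" for s using assms by (intro grid_weight_nonneg)
  have w1: "grid_weight p t s \<le> 1" for s
  proof (cases "s = 0")
    case False
    have "(real s)\<^sup>2 \<le> real p * L" if "real s \<le> sqrt (real p * L)"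
      using power_mono[OF that, of 2] L by simp
    then show ?thesis using L assms by (auto simp: grid_weight_def L_def divide_le_eq)
  qed (simp add: grid_weight_def)
  have fin: "finite I"
  proof (rule finite_imageD)
    show "finite ((\<lambda>i. 2 ^ i :: nat) ` I)"
      by (rule finite_subset[OF _ finite_Sgrid[OF assms]]) (auto simp: I_def)
  qed (auto simp: inj_on_def)
  have sub: "Sgrid p t \<subseteq> insert p ?S2 \<union> (\<lambda>i. 2 ^ i) ` I"
  proof
    fix s assume s: "s \<in> Sgrid p t"
    show "s \<in> insert p ?S2 \<union> (\<lambda>i. 2 ^ i) ` I"
    proof (cases "s = p \<or> s \<in> ?S2")
      case False
      then obtain i where i: "s = 2 ^ i" "2 ^ i \<le> sqrt (real p * L)"
        using s unfolding Sgrid_eq[OF assms] L_def by auto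
      have "L < real s"
        using False Sgrid_bounds(1)[OF assms s] le_nat_floor[of s L] by (meson atLeastAtMost_iff not_le)
      then show ?thesis using i s by (auto simp: I_def)
    qed auto
  qed
  have "(\<Sum>s\<in>Sgrid p t. grid_weight p t s) \<le> (\<Sum>s\<in>insert p ?S2 \<union> (\<lambda>i. 2 ^ i) ` I. grid_weight p t s)"
    by (rule sum_mono2) (use sub fin nn in auto)
  also have "\<dots> \<le> (\<Sum>s\<in>insert p ?S2. grid_weight p t s) + (\<Sum>s\<in>(\<lambda>i. 2 ^ i) ` I. grid_weight p t s)"
    using sum.union_inter[of "insert p ?S2" "(\<lambda>i. 2 ^ i) ` I" "grid_weight p t"]
      sum_nonneg[of "insert p ?S2 \<inter> (\<lambda>i. 2 ^ i) ` I" "grid_weight p t"] fin nn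
    by (smt (verit, best) finite_atLeastAtMost finite_imageI finite_insert)
  also have "(\<Sum>s\<in>insert p ?S2. grid_weight p t s) \<le> real (card (insert p ?S2)) * 1"
    by (rule sum_bounded_above) (rule w1)
  also have "\<dots> \<le> 1 + L"
  proof -
    have "card (insert p ?S2) \<le> Suc (nat \<lfloor>L\<rfloor>)" using card_insert_le_m1[of _ ?S2 p] by (simp add: card_insert_if)
    moreover have "real (nat \<lfloor>L\<rfloor>) \<le> L" using L by simp
    ultimately show ?thesis by linarith
  qed
  also have "(\<Sum>s\<in>(\<lambda>i. 2 ^ i) ` I. grid_weight p t s) = (\<Sum>i\<in>I. 4 ^ i / (real p * L))"
  proof (subst sum.reindex)
    have "((2::real) ^ i)\<^sup>2 = 4 ^ i" for i by (simp add: power2_eq_square flip: power_mult_distrib)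
    then show "sum (grid_weight p t \<circ> (\<lambda>i. 2 ^ i)) I = (\<Sum>i\<in>I. 4 ^ i / (real p * L))"
      by (intro sum.cong) (auto simp: I_def grid_weight_def L_def)
  qed (auto simp: inj_on_def)
  also have "\<dots> = (\<Sum>i\<in>I. 4 ^ i) / (real p * L)" by (rule sum_divide_distrib[symmetric])
  also have "\<dots> \<le> 2 * (real p * L) / (real p * L)"
  proof (intro divide_right_mono sum_power4_le fin)
    fix i assume "i \<in> I"
    then have "((2::real) ^ i)\<^sup>2 \<le> (sqrt (real p * L))\<^sup>2"
      by (intro power_mono) (auto simp: I_def)
    also have "((2::real) ^ i)\<^sup>2 = 4 ^ i" by (simp add: power2_eq_square flip: power_mult_distrib)
    finally show "4 ^ i \<le> real p * L" using L by simp
  qed (use L in auto)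
  finally have "(\<Sum>s\<in>Sgrid p t. grid_weight p t s) \<le> 1 + L + 2"
    using L(1) assms(1) by simp
  then show ?thesis using L(2,3) by linarith
qed

text \<open>The union bound over windows costs a factor t, the weighted one over sparsities a factor
  2t.\<close>

lemma alarm_Pmodel_infinity_le:
  fixes lam :: real
  defines "\<Lambda> \<equiv> lam / 16 - 8"
  assumes "0 < \<sigma>" "1 \<le> p" "2 \<le> t" "2 \<le> \<Lambda>"
  shows "measure (Pmodel \<sigma> \<mu>1 \<mu>2 \<infinity>) {Y \<in> space (Pmodel \<sigma> \<mu>1 \<mu>2 \<infinity>). alarm p \<sigma> lam t Y}
    \<le> 2 * real t powr (2 - \<Lambda>)"
proof -
  let ?P = "Pmodel \<sigma> \<mu>1 \<mu>2 \<infinity>"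
  interpret P: prob_space ?P by (rule prob_space_Pmodel) fact
  define E where "E g s = {Y \<in> space ?P. lam * zfun (real s) p (real t) < Astat p \<sigma> t s g Y}" for g s
  have E: "P.prob (E g s) \<le> real t powr (- \<Lambda>) * grid_weight p t s"
    if g: "g \<in> Ggrid t" and s: "s \<in> Sgrid p t" for g s
  proof -
    note s' = Sgrid_bounds[OF assms(3,4) s] and g' = Ggrid_bounds[OF assms(4) g]
    obtain \<eta> where \<eta>: "0 \<le> \<eta>" "\<eta> \<le> 1 / 16"
      "exp (2048 * \<eta>\<^sup>2 * real p * exp (- (thr p s t)\<^sup>2 / 4) - \<eta> * (lam * zfun (real s) p (real t)))
      \<le> real t powr (- \<Lambda>) * grid_weight p t s"
      using false_alarm_exponent[OF assms(3,4) s' assms(5)[unfolded \<Lambda>_def]] unfolding \<Lambda>_def by blast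
    show ?thesis unfolding E_def by (rule order_trans[OF Astat_upper_tail[OF assms(2) g' s'(1) \<eta>(1,2)] \<eta>(3)])
  qed
  have fin: "finite (Ggrid t)" "finite (Sgrid p t)"
    using finite_Ggrid finite_Sgrid assms by auto
  have Es: "E g s \<in> sets ?P" for g s unfolding E_def by measurable
  then have EU: "(\<Union>s\<in>Sgrid p t. E g s) \<in> sets ?P" for g
    by (rule sets.finite_UN[OF fin(2)])
  have "{Y \<in> space ?P. alarm p \<sigma> lam t Y} = (\<Union>g\<in>Ggrid t. \<Union>s\<in>Sgrid p t. E g s)"
    by (auto simp: alarm_def E_def)
  also have "P.prob (\<Union>g\<in>Ggrid t. \<Union>s\<in>Sgrid p t. E g s) \<le> (\<Sum>g\<in>Ggrid t. P.prob (\<Union>s\<in>Sgrid p t. E g s))"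
    by (rule P.finite_measure_subadditive_finite[OF fin(1)]) (intro image_subsetI EU)
  also have "\<dots> \<le> (\<Sum>g\<in>Ggrid t. \<Sum>s\<in>Sgrid p t. P.prob (E g s))"
    by (rule sum_mono, rule P.finite_measure_subadditive_finite[OF fin(2)]) (intro image_subsetI Es)
  also have "\<dots> \<le> (\<Sum>g\<in>Ggrid t. \<Sum>s\<in>Sgrid p t. real t powr (- \<Lambda>) * grid_weight p t s)"
    by (intro sum_mono E)
  also have "\<dots> = real (card (Ggrid t)) * (real t powr (- \<Lambda>) * (\<Sum>s\<in>Sgrid p t. grid_weight p t s))"
    by (simp add: sum_distrib_left)
  also have "\<dots> \<le> real t * (real t powr (- \<Lambda>) * (2 * real t))"
    using card_Ggrid_le[OF assms(4)] sum_grid_weight_le[OF assms(3,4)]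
    by (intro mult_mono mult_left_mono sum_nonneg mult_nonneg_nonneg grid_weight_nonneg) (use assms(4) in auto)
  also have "\<dots> = 2 * real t powr (2 - \<Lambda>)"
    using assms(4) by (simp add: powr_diff powr_minus power2_eq_square field_simps)
  finally show ?thesis .
qed

lemma sets_alarm:
  assumes "1 \<le> p" "2 \<le> t"
  shows "{Y \<in> space (Pmodel \<sigma> \<mu>1 \<mu>2 \<tau>). alarm p \<sigma>' lam t Y} \<in> sets (Pmodel \<sigma> \<mu>1 \<mu>2 \<tau>)"
  unfolding alarm_def
  using finite_Ggrid[OF assms(2)] finite_Sgrid[OF assms] by measurable

text \<open>The 12 in the condition on \<open>lam\<close> consists of the 8 lost in \<Lambda>, 2 for
  the union bound at time t and 2 for a summable series in t; the rest, at least c, makes the sum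
  small.\<close>

lemma false_alarm:
  assumes "0 < \<delta>" "0 < \<sigma>" "1 \<le> p" and lam: "12 / \<delta> \<le> c" "16 * (12 + c) \<le> lam"
  shows "{Y \<in> space (Pmodel \<sigma> \<mu>1 \<mu>2 \<infinity>). tauhat p \<sigma> lam Y < \<infinity>} \<in> sets (Pmodel \<sigma> \<mu>1 \<mu>2 \<infinity>)"
    and "measure (Pmodel \<sigma> \<mu>1 \<mu>2 \<infinity>) {Y \<in> space (Pmodel \<sigma> \<mu>1 \<mu>2 \<infinity>). tauhat p \<sigma> lam Y < \<infinity>} \<le> \<delta>"
proof -
  let ?P = "Pmodel \<sigma> \<mu>1 \<mu>2 \<infinity>"
  interpret P: prob_space ?P by (rule prob_space_Pmodel) fact
  define \<Lambda> where "\<Lambda> = lam / 16 - 8"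
  \<comment> \<open>The exponent left after the factor t^2 of the union bound and a factor t^(-2)
    reserved for summation.\<close>
  define m where "m = \<Lambda> - 4"
  have d: "0 < 12 / \<delta>" using assms by simp
  have c0: "0 < c" using d lam(1) by (rule less_le_trans)
  then have lam0: "0 < lam" using lam(2) by (simp add: algebra_simps)
  have "c \<le> m" using lam(2) by (simp add: m_def \<Lambda>_def)
  with lam(1) have m: "12 / \<delta> \<le> m" by (rule order_trans)
  have m0: "0 < m" using d m by (rule less_le_trans)
  then have \<Lambda>: "2 \<le> \<Lambda>" by (simp add: m_def)
  let ?A = "\<lambda>n. {Y \<in> space ?P. alarm p \<sigma> lam (n + 2) Y}"
  have eq: "{Y \<in> space ?P. tauhat p \<sigma> lam Y < \<infinity>} = (\<Union>n. ?A n)"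
  proof -
    have "(\<exists>t\<ge>2. alarm p \<sigma> lam t Y) \<longleftrightarrow> (\<exists>n. alarm p \<sigma> lam (n + 2) Y)" for Y
    proof
      assume "\<exists>t\<ge>2. alarm p \<sigma> lam t Y"
      then obtain t where t: "2 \<le> t" "alarm p \<sigma> lam t Y" by blast
      then have "t = t - 2 + 2" by simp
      with t(2) show "\<exists>n. alarm p \<sigma> lam (n + 2) Y" by metis
    next
      assume "\<exists>n. alarm p \<sigma> lam (n + 2) Y"
      then show "\<exists>t\<ge>2. alarm p \<sigma> lam t Y" by (meson le_add2)
    qed
    then show ?thesis unfolding tauhat_finite_iff[OF assms(3) lam0] by blast
  qed
  have A: "?A n \<in> sets ?P" for n using sets_alarm[OF assms(3), of "n + 2"] by simp
  show "{Y \<in> space ?P. tauhat p \<sigma> lam Y < \<infinity>} \<in> sets ?P"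
    unfolding eq using A by blast
  have sq: "(\<lambda>n. 1 / real ((n + 1)\<^sup>2)) sums (pi\<^sup>2 / 6)" by (rule inverse_squares_sums)
  \<comment> \<open>As t = n + 2 \<ge> 2, the margin gives 2^(-m); lowering n + 2 to n + 1 reduces
    the sum to that of inverse squares.\<close>
  have le: "P.prob (?A n) \<le> 2 * 2 powr (- m) * (1 / real ((n + 1)\<^sup>2))" for n
  proof -
    have "P.prob (?A n) \<le> 2 * real (n + 2) powr (2 - \<Lambda>)"
      unfolding \<Lambda>_def by (rule alarm_Pmodel_infinity_le) (use assms \<Lambda> in \<open>auto simp: \<Lambda>_def\<close>)
    also have "real (n + 2) powr (2 - \<Lambda>) = real (n + 2) powr (- m) * real (n + 2) powr (- 2)"
      unfolding powr_add[symmetric] by (simp add: m_def)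
    also have "\<dots> \<le> 2 powr (- m) * (1 / real ((n + 1)\<^sup>2))"
    proof (intro mult_mono)
      show "real (n + 2) powr (- m) \<le> 2 powr (- m)"
        using m0 by (intro powr_mono2') auto
      have "real (n + 2) powr (- 2) = 1 / (real (n + 2))\<^sup>2"
        by (simp add: powr_minus divide_inverse)
      also have "\<dots> \<le> 1 / (real (n + 1))\<^sup>2" by (intro divide_left_mono power_mono) auto
      finally show "real (n + 2) powr (- 2) \<le> 1 / real ((n + 1)\<^sup>2)" by simp
    qed auto
    finally show ?thesis by (simp add: mult.assoc)
  qed
  have sums: "(\<lambda>n. 2 * 2 powr (- m) * (1 / real ((n + 1)\<^sup>2))) sums (2 * 2 powr (- m) * (pi\<^sup>2 / 6))"
    by (intro sums_mult sq)
  have smb: "summable (\<lambda>n. P.prob (?A n))"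
    by (rule summable_comparison_test'[OF sums_summable[OF sums], of 0])
       (use le in \<open>simp only: real_norm_def abs_of_nonneg[OF measure_nonneg]\<close>)
  have "P.prob (\<Union>n. ?A n) \<le> (\<Sum>n. P.prob (?A n))"
    by (rule P.finite_measure_subadditive_countably[OF _ smb]) (use A in blast)
  also have "\<dots> \<le> (\<Sum>n. 2 * 2 powr (- m) * (1 / real ((n + 1)\<^sup>2)))"
    by (rule suminf_le[OF le smb sums_summable[OF sums]])
  also have "\<dots> = 2 * 2 powr (- m) * (pi\<^sup>2 / 6)" using sums by (rule sums_unique[symmetric])
  \<comment> \<open>From 2^m \<ge> m log 2 \<ge> m/2 and pi^2/6 \<le> 3; the product 12/m explains
    the choice 12/\<delta>.\<close>
  also have "\<dots> \<le> 2 * (2 / m) * 3"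
  proof (intro mult_mono mult_left_mono)
    have "m / 2 \<le> m * ln 2" using ln2_ge_two_thirds m0 by (intro order_trans[OF _ mult_left_mono[of "1/2" "ln 2" m]]) auto
    also have "\<dots> \<le> exp (m * ln 2)"
      using exp_ge_add_one_self[of "m * ln 2"] by linarith
    also have "\<dots> = 2 powr m" by (simp add: powr_def)
    finally show "2 powr (- m) \<le> 2 / m"
      using m0 by (simp add: powr_minus field_simps)
    have "pi\<^sup>2 \<le> 4\<^sup>2" using pi_less_4 pi_gt_zero by (intro power_mono) auto
    then show "pi\<^sup>2 / 6 \<le> 3" by simp
  qed (use m0 in auto)
  also have "\<dots> \<le> \<delta>" using m m0 assms(1) by (simp add: field_simps)
  finally show "P.prob {Y \<in> space ?P. tauhat p \<sigma> lam Y < \<infinity>} \<le> \<delta>" unfolding eq .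
qed

section \<open>Detection delay\<close>

text \<open>At threshold zero the indicator is one almost everywhere, so centring forces the full
  second moment.\<close>

lemma nu_0: "nu 0 = 1"
proof -
  have "(LINT x|lborel. std_normal_density x * ((x\<^sup>2 - nu 0) * indicator {x. 0 < \<bar>x\<bar>} x))
      = (LINT x|lborel. std_normal_density x * (x\<^sup>2 - 1) + (1 - nu 0) * std_normal_density x)"
    by (rule integral_cong_AE)
       (use AE_lborel_singleton[of "0::real"] in \<open>auto simp: algebra_simps elim!: eventually_mono\<close>)
  also have "\<dots> = (LINT x|lborel. std_normal_density x * (x\<^sup>2 - 1)) + (1 - nu 0)"
  proof (subst Bochner_Integration.integral_add)
    have "integrable lborel (\<lambda>x. std_normal_density x * x^2 - std_normal_density x * x^0)"
      by (intro Bochner_Integration.integrable_diff integrable_std_normal_moment)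
    then show "integrable lborel (\<lambda>x. std_normal_density x * (x\<^sup>2 - 1))"
      by (simp add: right_diff_distrib)
  qed (simp_all add: integral_normal_density)
  finally show ?thesis
    using integral_std_normal_centred[of 0] integral_std_normal_square_centred by simp
qed

section \<open>Lower tails of the statistic under a change\<close>

context
  fixes \<sigma> :: real and \<mu>1 \<mu>2 :: "nat \<Rightarrow> real" and \<tau> :: enat and p t g :: nat
    and b :: "nat \<Rightarrow> real" and B :: real
  assumes \<sigma>: "0 < \<sigma>" and g: "1 \<le> g" "g < t" and p: "1 \<le> p"
  defines "b \<equiv> \<lambda>j. cusum t g j (obs_mean \<mu>1 \<mu>2 \<tau>) / \<sigma>"
    and "B \<equiv> \<Sum>j<p. (b j)\<^sup>2"
begin

private abbreviation (input) "PY \<equiv> Pmodel \<sigma> \<mu>1 \<mu>2 \<tau>"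
private abbreviation (input) "Z \<equiv> noise \<sigma> (obs_mean \<mu>1 \<mu>2 \<tau>) t g"

lemma Astat_eq_shifted:
  "Astat p \<sigma> t s g Y = (\<Sum>j<p. centred (thr p s t) (Z j Y + b j))"
  unfolding Astat_eq_centred[OF \<sigma>] b_def
  using \<sigma> cusum_eq_noise[of \<sigma> t g _ Y "obs_mean \<mu>1 \<mu>2 \<tau>"]
  by (intro sum.cong) (simp_all add: add_divide_distrib)

lemma chernoff_noise:
  assumes "finite J" "\<And>j. f j \<in> borel_measurable borel"
    "\<And>j. j \<in> J \<Longrightarrow>
      (\<integral>\<^sup>+x. ennreal (std_normal_density x) * ennreal (exp (f j x)) \<partial>lborel) \<le> ennreal (exp (v j))"
  shows "measure PY {Y \<in> space PY. x \<le> (\<Sum>j\<in>J. f j (Z j Y))} \<le> exp ((\<Sum>j\<in>J. v j) - x)"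
  by (rule prob_space.chernoff_std_normal[OF prob_space_Pmodel[OF \<sigma>]])
     (use assms \<sigma> g in \<open>auto intro: indep_vars_noise distributed_noise\<close>)

text \<open>With threshold zero the statistic is at least the sum of (Z + b)^2 - 1. Its expansion is
  a centred chi-square sum, a linear form in the noise and B; the linear form may eat half of
  B.\<close>

lemma Astat_lower_tail_dense:
  assumes dense: "\<not> real s \<le> sqrt (real p * ln (real t))"
  shows "measure PY {Y \<in> space PY. Astat p \<sigma> t s g Y \<le> B / 2 - M * sqrt (real p)}
    \<le> exp (8 - M / 16) + exp (- B / 32)"
proof -
  interpret P: prob_space PY by (rule prob_space_Pmodel) (rule \<sigma>)
  have p0: "0 < real p" "1 \<le> sqrt (real p)" using p by auto
  \<comment> \<open>Of order p^(-1/2), so that the quadratic cost 2048 \<eta>^2 p is the constant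
    8.\<close>
  define \<eta> where "\<eta> = 1 / (16 * sqrt (real p))"
  let ?E1 = "{Y \<in> space PY. M / 16 \<le> (\<Sum>j<p. (- \<eta>) * ((Z j Y)\<^sup>2 - 1))}"
  \<comment> \<open>Rate 1/4 for the event that the sum of b Z is at most -B/4: the exponent is B/32
    - B/16.\<close>
  let ?E2 = "{Y \<in> space PY. B / 16 \<le> (\<Sum>j<p. (- b j / 4) * Z j Y)}"
  have 1: "P.prob ?E1 \<le> exp ((\<Sum>j<p. 2048 * (- \<eta>)\<^sup>2) - M / 16)"
    by (rule chernoff_noise[where f = "\<lambda>_ x. (- \<eta>) * (x\<^sup>2 - 1)"], simp, measurable,
        rule nn_integral_exp_square_centred_le) (use p0 in \<open>simp add: \<eta>_def field_simps\<close>)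
  have "(\<Sum>j<p. 2048 * (- \<eta>)\<^sup>2) = 8"
    using p0 by (simp add: \<eta>_def power_divide power_mult_distrib)
  note 1 = 1[unfolded this]
  have 2: "P.prob ?E2 \<le> exp ((\<Sum>j<p. (- b j / 4)\<^sup>2 / 2) - B / 16)"
    by (rule chernoff_noise[where f = "\<lambda>j x. (- b j / 4) * x"], simp, measurable,
        rule eq_refl, rule nn_integral_exp_linear)
  have "(\<Sum>j<p. (- b j / 4)\<^sup>2 / 2) - B / 16 = - B / 32"
    unfolding B_def sum_divide_distrib by (simp add: power_divide sum_divide_distrib[symmetric])
  note 2 = 2[unfolded this]
  have "{Y \<in> space PY. Astat p \<sigma> t s g Y \<le> B / 2 - M * sqrt (real p)} \<subseteq> ?E1 \<union> ?E2"
  proof (rule subsetI, rule ccontr)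
    fix Y assume Y: "Y \<in> {Y \<in> space PY. Astat p \<sigma> t s g Y \<le> B / 2 - M * sqrt (real p)}"
      and not: "Y \<notin> ?E1 \<union> ?E2"
    have n1: "(\<Sum>j<p. (- \<eta>) * ((Z j Y)\<^sup>2 - 1)) < M / 16"
      and n2: "(\<Sum>j<p. (- b j / 4) * Z j Y) < B / 16" using Y not by auto
    define S where "S = (\<Sum>j<p. (Z j Y)\<^sup>2 - 1)"
    have "(- \<eta>) * S < M / 16" using n1 by (simp only: S_def sum_distrib_left)
    then have n1: "- (M * sqrt (real p)) < S"
      using p0 by (simp add: \<eta>_def field_simps)
    have "(\<Sum>j<p. (- b j / 4) * Z j Y) = (- 1 / 4) * (\<Sum>j<p. b j * Z j Y)"
      by (simp add: sum_distrib_left)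
    with n2 have n2: "- B / 4 < (\<Sum>j<p. b j * Z j Y)" by simp
    have "S + 2 * (\<Sum>j<p. b j * Z j Y) + B
        = (\<Sum>j<p. (Z j Y + b j)\<^sup>2 - 1)"
      unfolding S_def B_def sum_distrib_left sum.distrib[symmetric]
      by (intro sum.cong) (simp_all add: power2_sum algebra_simps)
    also have "\<dots> \<le> Astat p \<sigma> t s g Y"
      unfolding Astat_eq_shifted thr_eq_0[OF dense] using centred_ge[of 0] nu_0
      by (intro sum_mono) simp
    finally show False using Y n1 n2 by simp
  qed
  then have "P.prob {Y \<in> space PY. Astat p \<sigma> t s g Y \<le> B / 2 - M * sqrt (real p)} \<le> P.prob (?E1 \<union> ?E2)"
    by (rule P.finite_measure_mono) measurable
  also have "\<dots> \<le> P.prob ?E1 + P.prob ?E2"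
    by (rule measure_Un_le) measurable
  finally show ?thesis using 1 2 by linarith
qed

text \<open>Off the support of b the summands are centred noise, with deviation of order s. On the
  support (Z + b)^2 \<ge> b^2/2 - Z^2, which costs k times \<open>nu\<close> and a chi-square sum of
  k terms.\<close>

lemma Astat_lower_tail_sparse:
  fixes s :: nat and M :: real
  defines "k \<equiv> card {j. j < p \<and> b j \<noteq> 0}"
  assumes sparse: "real s \<le> sqrt (real p * ln (real t))" and s: "1 \<le> s" and k: "1 \<le> k" and M: "3 \<le> M"
  shows "measure PY {Y \<in> space PY.
      Astat p \<sigma> t s g Y \<le> B / 2 - M * real k - M * real s - real k * nu (thr p s t)}
    \<le> 2 * exp (8 - M / 16)"
proof -
  interpret P: prob_space PY by (rule prob_space_Pmodel) (rule \<sigma>)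
  let ?a = "thr p s t"
  have a: "0 \<le> ?a" by (rule thr_nonneg) (rule s)
  have t: "2 \<le> t" using g by simp
  define L where "L = ln (real t)"
  have L: "2 / 3 \<le> L"
  proof -
    have "ln 2 \<le> ln (real t)" using t by simp
    then show ?thesis using ln2_ge_two_thirds unfolding L_def by linarith
  qed
  define K where "K = {j. j < p \<and> b j \<noteq> 0}"
  have K: "finite K" "K \<subseteq> {..<p}" "card K = k" by (auto simp: K_def k_def)
  define \<eta> where "\<eta> = 1 / (16 * real s)"
  let ?N = "{..<p} - K"
  let ?E1 = "{Y \<in> space PY. M / 16 \<le> (\<Sum>j\<in>?N. (- \<eta>) * centred ?a (Z j Y))}"
  let ?E2 = "{Y \<in> space PY. 3 / 8 * (M * real k) \<le> (\<Sum>j\<in>K. 3 / 8 * (Z j Y)\<^sup>2)}"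
  have 1: "P.prob ?E1 \<le> exp ((\<Sum>j\<in>?N. 2048 * (- \<eta>)\<^sup>2 * exp (- ?a\<^sup>2 / 4)) - M / 16)"
    by (rule chernoff_noise[where f = "\<lambda>_ x. (- \<eta>) * centred ?a x"], simp, measurable,
        rule nn_integral_exp_centred_le[OF a]) (use s in \<open>simp add: \<eta>_def field_simps\<close>)
  \<comment> \<open>Extended to all p coordinates, the cost is 8/(eL) because p exp(-a^2/4) =
    s^2/(eL) and \<eta>^2 = 1/(256 s^2).\<close>
  have "(\<Sum>j\<in>?N. 2048 * (- \<eta>)\<^sup>2 * exp (- ?a\<^sup>2 / 4)) \<le> (\<Sum>j<p. 2048 * (- \<eta>)\<^sup>2 * exp (- ?a\<^sup>2 / 4))"
    by (intro sum_mono2) auto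
  also have "\<dots> = 8 / (exp 1 * L)"
    unfolding exp_thr[OF s p t sparse]
    using s p L by (simp add: L_def \<eta>_def power_divide power_mult_distrib)
  also have "\<dots> \<le> 8"
  proof -
    have "2 * (2 / 3) \<le> exp 1 * L"
      using L exp_ge_add_one_self[of 1] by (intro mult_mono) auto
    then show ?thesis by (simp add: divide_le_eq)
  qed
  finally have "P.prob ?E1 \<le> exp (8 - M / 16)"
    by (intro order_trans[OF 1]) simp
  note 1 = this
  have 2: "P.prob ?E2 \<le> exp ((\<Sum>j\<in>K. 1) - 3 / 8 * (M * real k))"
    by (rule chernoff_noise[where f = "\<lambda>_ x. 3 / 8 * x\<^sup>2"], rule K, measurable,
        rule nn_integral_exp_square_le)
  also have "\<dots> \<le> exp (8 - M / 16)"
  proof -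
    have "(\<Sum>j\<in>K. 1) - 3 / 8 * (M * real k) = real k * (1 - 3 / 8 * M)"
      using K by (simp add: algebra_simps)
    \<comment> \<open>M \<ge> 3 makes the factor negative, so k = 1 is the worst case.\<close>
    also have "\<dots> \<le> 1 * (1 - 3 / 8 * M)"
      using k M by (intro mult_right_mono_neg) auto
    also have "\<dots> \<le> 8 - M / 16" using M by simp
    finally show ?thesis by simp
  qed
  finally have 2: "P.prob ?E2 \<le> exp (8 - M / 16)" .
  let ?E = "{Y \<in> space PY. Astat p \<sigma> t s g Y \<le> B / 2 - M * real k - M * real s - real k * nu ?a}"
  have "?E \<subseteq> ?E1 \<union> ?E2"
  proof (rule subsetI, rule ccontr)
    fix Y assume Y: "Y \<in> ?E" and not: "Y \<notin> ?E1 \<union> ?E2"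
    have n1: "(\<Sum>j\<in>?N. (- \<eta>) * centred ?a (Z j Y)) < M / 16"
      and n2: "(\<Sum>j\<in>K. 3 / 8 * (Z j Y)\<^sup>2) < 3 / 8 * (M * real k)" using Y not by auto
    define S where "S = (\<Sum>j\<in>?N. centred ?a (Z j Y))"
    have "(- \<eta>) * S < M / 16" using n1 by (simp only: S_def sum_distrib_left)
    then have n1: "- (M * real s) < S"
      using s by (simp add: \<eta>_def field_simps)
    have n2: "(\<Sum>j\<in>K. (Z j Y)\<^sup>2) < M * real k"
      using n2 unfolding sum_distrib_left[symmetric] by simp
    have BK: "B = (\<Sum>j\<in>K. (b j)\<^sup>2)"
      unfolding B_def by (rule sum.mono_neutral_right) (auto simp: K_def)
    have "B / 2 - (\<Sum>j\<in>K. (Z j Y)\<^sup>2) - real k * nu ?a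
        = (\<Sum>j\<in>K. (b j)\<^sup>2 / 2 - (Z j Y)\<^sup>2 - nu ?a)"
      unfolding BK by (simp add: sum_subtractf sum_divide_distrib K)
    also have "\<dots> \<le> (\<Sum>j\<in>K. centred ?a (Z j Y + b j))"
    proof (rule sum_mono)
      fix j
      have "0 \<le> (2 * Z j Y + b j)\<^sup>2 / 2" by simp
      also have "\<dots> = (Z j Y + b j)\<^sup>2 - ((b j)\<^sup>2 / 2 - (Z j Y)\<^sup>2)"
        by (simp add: power2_eq_square field_simps)
      finally show "(b j)\<^sup>2 / 2 - (Z j Y)\<^sup>2 - nu ?a \<le> centred ?a (Z j Y + b j)"
        using centred_ge[OF a, of "Z j Y + b j"] by linarith
    qed
    finally have "B / 2 - (\<Sum>j\<in>K. (Z j Y)\<^sup>2) - real k * nu ?a \<le> (\<Sum>j\<in>K. centred ?a (Z j Y + b j))" .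
    moreover have "Astat p \<sigma> t s g Y
        = S + (\<Sum>j\<in>K. centred ?a (Z j Y + b j))"
    proof -
      have "(\<Sum>j\<in>?N. centred ?a (Z j Y + b j)) = (\<Sum>j\<in>?N. centred ?a (Z j Y))"
        by (intro sum.cong) (auto simp: K_def)
      then show ?thesis
        unfolding Astat_eq_shifted S_def using sum.subset_diff[OF K(2), of "\<lambda>j. centred ?a (Z j Y + b j)"] by simp
    qed
    ultimately show False using Y n1 n2 by simp
  qed
  then have "P.prob ?E \<le> P.prob (?E1 \<union> ?E2)"
    by (rule P.finite_measure_mono) measurable
  also have "\<dots> \<le> P.prob ?E1 + P.prob ?E2"
    by (rule measure_Un_le) measurable
  finally show ?thesis using 1 2 by linarith
qed

end

text \<open>Lets the bound at 2\<tau> serve at every t \<le> 2\<tau>. If k is dense at t but sparse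
  at the later time, then sqrt(p log t) < k, and k is at most k times a logarithm that is at least
  1.\<close>

lemma zfun_mono:
  assumes "1 \<le> p" "2 \<le> t" "t \<le> t'" "0 < k"
  shows "zfun k p t \<le> zfun k p t'"
proof -
  have L: "0 < ln t" "ln t \<le> ln t'" using assms by auto
  then have r: "sqrt (real p * ln t) \<le> sqrt (real p * ln t')" by (simp add: mult_left_mono)
  consider "k > sqrt (real p * ln t')" | "sqrt (real p * ln t) < k" "k \<le> sqrt (real p * ln t')"
    | "k \<le> sqrt (real p * ln t)" by linarith
  then show ?thesis
  proof cases
    case 1
    then show ?thesis using r le_less_trans[OF r 1] by (simp add: zfun_def)
  next
    case 2
    have "sqrt (real p * ln t) \<le> k * 1" using 2 by simp
    also have "\<dots> \<le> k * ln (exp 1 * real p * ln t' / k\<^sup>2)"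
      using assms 2 by (intro mult_left_mono ln_ratio_ge_1) auto
    finally show ?thesis using 2 by (simp add: zfun_def)
  next
    case 3
    have "ln (exp 1 * real p * ln t / k\<^sup>2) \<le> ln (exp 1 * real p * ln t' / k\<^sup>2)"
      using assms L by (intro ln_mono divide_right_mono mult_left_mono) auto
    then have "k * ln (exp 1 * real p * ln t / k\<^sup>2) \<le> k * ln (exp 1 * real p * ln t' / k\<^sup>2)"
      using assms by (intro mult_left_mono) auto
    then show ?thesis using 3 order_trans[OF 3 r] L by (auto simp: zfun_def)
  qed
qed

text \<open>A single pair (g, s) exceeding its threshold suffices: s = p for dense k, otherwise a
  power of two within a factor two of k.\<close>

lemma alarm_prob_ge:
  fixes \<delta> x M C2 lam \<sigma> :: real and \<mu>1 \<mu>2 :: "nat \<Rightarrow> real" and \<tau> :: enat and p t g k :: nat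
  defines "b \<equiv> \<lambda>j. cusum t g j (obs_mean \<mu>1 \<mu>2 \<tau>) / \<sigma>"
  assumes "0 < lam" "0 < \<sigma>" "1 \<le> p" and t: "2 \<le> t" and gG: "g \<in> Ggrid t"
    and x: "0 \<le> x" and M: "M = 16 * (8 + x)"
    and k: "k = card {j. j < p \<and> b j \<noteq> 0}" "1 \<le> k"
    and B: "2 * (2 * M + 15 + 3 * lam) * zfun (real k) p (real t) \<le> (\<Sum>j<p. (b j)\<^sup>2)"
  shows "1 - 2 * exp (- x)
    \<le> measure (Pmodel \<sigma> \<mu>1 \<mu>2 \<tau>) {Y \<in> space (Pmodel \<sigma> \<mu>1 \<mu>2 \<tau>). alarm p \<sigma> lam t Y}"
proof -
  let ?P = "Pmodel \<sigma> \<mu>1 \<mu>2 \<tau>"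
  interpret P: prob_space ?P by (rule prob_space_Pmodel) fact
  define B' where "B' = (\<Sum>j<p. (b j)\<^sup>2)"
  define L where "L = ln (real t)"
  define z where "z = zfun (real k) p (real t)"
  have L: "2 / 3 \<le> L"
  proof -
    have "ln 2 \<le> ln (real t)" using t by simp
    then show ?thesis using ln2_ge_two_thirds unfolding L_def by linarith
  qed
  note g = Ggrid_bounds[OF t gG]
  have kp: "k \<le> p" unfolding k using card_mono[of "{..<p}" "{j. j < p \<and> b j \<noteq> 0}"] by auto
  \<comment> \<open>M is chosen to turn the deviation bounds into exp(-x).\<close>
  have "8 - M / 16 = - x" unfolding M by (simp add: field_simps)
  then have Mx: "exp (8 - M / 16) = exp (- x)" "3 \<le> M" using x by (simp_all add: M)
  have z0: "0 < z" unfolding z_def using assms by (intro zfun_pos) auto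
  \<comment> \<open>Half the signal must cover 2Mz for noise, 14z for \<open>nu\<close>, 3 lam z for
    the threshold, and a positive remainder z.\<close>
  have B2: "2 * M * z + 15 * z + 3 * lam * z \<le> B' / 2" using B by (simp add: z_def B'_def algebra_simps)
  have main: "1 - 2 * exp (- x) \<le> P.prob {Y \<in> space ?P. alarm p \<sigma> lam t Y}"
    if s: "s \<in> Sgrid p t" and le: "P.prob {Y \<in> space ?P. Astat p \<sigma> t s g Y \<le> c} \<le> 2 * exp (- x)"
      and c: "lam * zfun (real s) p (real t) \<le> c" for s c
  proof -
    have "{Y \<in> space ?P. \<not> alarm p \<sigma> lam t Y} \<subseteq> {Y \<in> space ?P. Astat p \<sigma> t s g Y \<le> c}"
      using s gG c unfolding alarm_def by force
    then have "P.prob {Y \<in> space ?P. \<not> alarm p \<sigma> lam t Y} \<le> P.prob {Y \<in> space ?P. Astat p \<sigma> t s g Y \<le> c}"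
      by (rule P.finite_measure_mono) measurable
    moreover have "P.prob {Y \<in> space ?P. \<not> alarm p \<sigma> lam t Y} = 1 - P.prob {Y \<in> space ?P. alarm p \<sigma> lam t Y}"
      by (rule P.prob_neg) (rule sets_alarm; fact)
    ultimately show ?thesis using le by linarith
  qed
  show ?thesis
  proof (cases "real k \<le> sqrt (real p * L)")
    case False
    have z: "z = sqrt (real p * L)" using False by (simp add: z_def zfun_def L_def)
    have pk: "\<not> real p \<le> sqrt (real p * L)" using False kp by (meson of_nat_le_iff order_trans)
    have zp: "zfun (real p) p (real t) = z" using pk by (simp add: zfun_def L_def z)
    \<comment> \<open>log t \<ge> 2/3 gives 1 \<le> 4 log t, so the noise level sqrt(p) is
      comparable to z.\<close>
    have sp: "sqrt (real p) \<le> 2 * z"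
    proof -
      have "real p * 1 \<le> real p * (4 * L)" using L by (intro mult_left_mono) auto
      then have "sqrt (real p) \<le> sqrt (2\<^sup>2 * (real p * L))" by (intro real_sqrt_le_mono) simp
      also have "\<dots> = 2 * z" unfolding z real_sqrt_mult[of "2\<^sup>2"] by simp
      finally show ?thesis .
    qed
    have z1: "1 / 2 \<le> z" using sp assms(4) real_sqrt_ge_1_iff[of "real p"] by linarith
    have "P.prob {Y \<in> space ?P. Astat p \<sigma> t p g Y \<le> B' / 2 - M * sqrt (real p)}
        \<le> exp (8 - M / 16) + exp (- B' / 32)"
      unfolding B'_def b_def
      by (rule Astat_lower_tail_dense) (use assms g pk in \<open>auto simp: L_def\<close>)
    also have "\<dots> \<le> 2 * exp (- x)"
    proof -
      \<comment> \<open>With 2z \<ge> 1 the signal condition yields B'/32 \<ge> M/16 = 8 + x, which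
        handles the linear noise term.\<close>
      have "M * 1 \<le> M * (2 * z)" using z1 Mx by (intro mult_left_mono) auto
      moreover have "M * (2 * z) = 2 * M * z" by simp
      moreover have "0 < 15 * z + 3 * lam * z" using z0 assms(2) by (simp add: add_pos_pos)
      ultimately have "M \<le> B' / 2" using B2 by linarith
      then have "x \<le> B' / 32" using x by (simp add: M)
      then show ?thesis unfolding Mx by simp
    qed
    finally show ?thesis
    proof (rule main[rotated])
      show "p \<in> Sgrid p t" by (simp add: Sgrid_def)
      have "M * sqrt (real p) \<le> M * (2 * z)" using sp Mx by (intro mult_left_mono) auto
      moreover have "0 < lam * z" using z0 assms(2) by simp
      ultimately show "lam * zfun (real p) p (real t) \<le> B' / 2 - M * sqrt (real p)"
        using B2 z0 unfolding zp by simp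
    qed
  next
    case True
    define i where "i = floor_log k"
    define s :: nat where "s = 2 ^ i"
    have s: "s \<le> k" "k < 2 * s" "1 \<le> s"
      using floor_log_exp2_le[of k] floor_log_exp2_gt[of k] k(2) by (auto simp: s_def i_def)
    have sL: "real s \<le> sqrt (real p * L)" using s True by linarith
    have sS: "s \<in> Sgrid p t"
    proof -
      have "2 ^ i \<le> sqrt (real p * ln (real t))" using sL by (simp add: s_def L_def)
      moreover have "real s \<le> real p" using s(1) kp by linarith
      then have "(2::real) ^ i \<le> real p" by (simp add: s_def)
      ultimately show ?thesis unfolding Sgrid_eq[OF assms(4) t] s_def by blast
    qed
    define l where "l = ln (exp 1 * real p * L / (real k)\<^sup>2)"
    define l' where "l' = ln (exp 1 * real p * L / (real s)\<^sup>2)"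
    have p0: "0 < real p" "0 < real k" "0 < real s" using assms(4) k(2) s by auto
    have l: "1 \<le> l" unfolding l_def using True p0 by (intro ln_ratio_ge_1) auto
    have l'1: "1 \<le> l'" unfolding l'_def using sL p0 by (intro ln_ratio_ge_1) auto
    \<comment> \<open>As s > k/2, the ratio grows by at most a factor 4, and ln 4 \<le> 2 \<le>
      2l.\<close>
    have l': "l' \<le> 3 * l"
    proof -
      have "(real k)\<^sup>2 \<le> (2 * real s)\<^sup>2" using s by (intro power_mono) auto
      then have "1 / (real s)\<^sup>2 \<le> 4 / (real k)\<^sup>2" using p0 by (simp add: field_simps)
      then have "exp 1 * real p * L * (1 / (real s)\<^sup>2) \<le> exp 1 * real p * L * (4 / (real k)\<^sup>2)"
        using L by (intro mult_left_mono) auto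
      then have "l' \<le> ln (4 * (exp 1 * real p * L / (real k)\<^sup>2))"
        unfolding l'_def using p0 L by (intro ln_mono) (auto simp: mult_ac)
      also have "\<dots> = ln 4 + l"
        unfolding l_def using p0 L by (subst ln_mult) auto
      also have "ln (4::real) \<le> 2"
      proof -
        have "ln ((2::real)\<^sup>2) = 2 * ln 2" by (subst ln_realpow) auto
        then show ?thesis using ln_le_minus_one[of "2::real"] by simp
      qed
      finally show ?thesis using l by simp
    qed
    have z: "z = max (real k * l) L" using True by (simp add: z_def zfun_def L_def l_def)
    have kl: "real k \<le> real k * l" "real k * l \<le> z" "L \<le> z" using l by (simp_all add: z mult_le_cancel_left1)
    have zs: "zfun (real s) p (real t) \<le> 3 * z"
    proof -
      have "real s * l' \<le> real k * (3 * l)" using s l'1 l' by (intro mult_mono) auto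
      then show ?thesis using kl z0 sL by (simp add: zfun_def L_def[symmetric] l'_def[symmetric])
    qed
    \<comment> \<open>The bound nu \<le> a^2 + 2 = 4l' + 2 \<le> 12l + 2 \<le> 14l.\<close>
    have nu: "real k * nu (thr p s t) \<le> 14 * z"
    proof -
      have "nu (thr p s t) \<le> 4 * l' + 2"
        using nu_le[OF thr_nonneg[OF s(3)], of p t] thr_power2[OF s(3) assms(4) t] sL by (simp add: L_def l'_def)
      then have "nu (thr p s t) \<le> 14 * l" using l l' by simp
      then have "real k * nu (thr p s t) \<le> real k * (14 * l)" by (intro mult_left_mono) auto
      then show ?thesis using kl by simp
    qed
    have "P.prob {Y \<in> space ?P. Astat p \<sigma> t s g Y \<le> B' / 2 - M * real k - M * real s - real k * nu (thr p s t)}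
        \<le> 2 * exp (8 - M / 16)"
      unfolding B'_def b_def k(1)
      by (rule Astat_lower_tail_sparse) (use assms g sL s Mx k in \<open>auto simp: L_def b_def\<close>)
    also have "\<dots> = 2 * exp (- x)" by (simp add: Mx)
    finally show ?thesis
    proof (rule main[OF sS])
      have "real k \<le> z" using kl(1,2) by (rule order_trans)
      moreover from this have "real s \<le> z" using s(1) by linarith
      ultimately have "M * real k \<le> M * z" "M * real s \<le> M * z"
        using Mx(2) by (simp_all add: mult_left_mono)
      moreover have "lam * zfun (real s) p (real t) \<le> lam * (3 * z)"
        using zs assms(2) by (intro mult_left_mono) auto
      ultimately show "lam * zfun (real s) p (real t)
          \<le> B' / 2 - M * real k - M * real s - real k * nu (thr p s t)"
        using B2 nu z0 by simp
    qed
  qed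
qed

section \<open>From an alarm at one time to the delay bound\<close>

lemma sets_tauhat_le:
  assumes "1 \<le> p" "0 < lam"
  shows "{Y \<in> space (Pmodel \<sigma> \<mu>1 \<mu>2 \<tau>). tauhat p \<sigma>' lam Y \<le> enat n} \<in> sets (Pmodel \<sigma> \<mu>1 \<mu>2 \<tau>)"
proof -
  have "{Y \<in> space (Pmodel \<sigma> \<mu>1 \<mu>2 \<tau>). tauhat p \<sigma>' lam Y \<le> enat n}
      = (\<Union>t\<in>{2..n}. {Y \<in> space (Pmodel \<sigma> \<mu>1 \<mu>2 \<tau>). alarm p \<sigma>' lam t Y})"
    unfolding tauhat_le_iff[OF assms] by blast
  also have "\<dots> \<in> sets (Pmodel \<sigma> \<mu>1 \<mu>2 \<tau>)"
    by (intro sets.finite_UN sets_alarm assms) auto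
  finally show ?thesis .
qed

text \<open>An alarm at the single time \<tau> + d suffices. The window quality 1/16 there turns the
  factor 2(2M + 15 + 3 lam) with M = 16(8 + x) into \<open>C2\<close>.\<close>

lemma detection_delay:
  fixes \<delta> x C2 lam \<sigma> :: real and \<mu>1 \<mu>2 :: "nat \<Rightarrow> real" and \<tau> p :: nat
  assumes lam: "0 < lam" and \<sigma>: "0 < \<sigma>" and p: "1 \<le> p" and \<tau>: "1 \<le> \<tau>"
    and x: "0 \<le> x" and C2: "C2 = 32 * (32 * (8 + x) + 15 + 3 * lam)"
    and signal: "C2 * zfun (real (sparsity p \<mu>1 \<mu>2)) p (2 * real \<tau>) \<le> real \<tau> * (l2diff p \<mu>1 \<mu>2)\<^sup>2 / \<sigma>\<^sup>2"
  shows "1 - 2 * exp (- x) \<le> measure (Pmodel \<sigma> \<mu>1 \<mu>2 (enat \<tau>))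
    {Y \<in> space (Pmodel \<sigma> \<mu>1 \<mu>2 (enat \<tau>)).
      tauhat p \<sigma> lam Y \<le> enat \<tau> + enat (nat \<lceil>C2 * \<sigma>\<^sup>2 / (l2diff p \<mu>1 \<mu>2)\<^sup>2
        * zfun (real (sparsity p \<mu>1 \<mu>2)) p (2 * real \<tau>)\<rceil>)}"
proof -
  let ?P = "Pmodel \<sigma> \<mu>1 \<mu>2 (enat \<tau>)"
  interpret P: prob_space ?P by (rule prob_space_Pmodel) fact
  define k where "k = sparsity p \<mu>1 \<mu>2"
  define F where "F = (l2diff p \<mu>1 \<mu>2)\<^sup>2"
  define z where "z = zfun (real k) p (2 * real \<tau>)"
  have F: "F = (\<Sum>j<p. (\<mu>2 j - \<mu>1 j)\<^sup>2)" by (simp add: F_def l2diff_def sum_nonneg)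
  have z0: "0 < z" unfolding z_def using p \<tau> by (intro zfun_pos) auto
  have C20: "0 < C2" unfolding C2 using x lam by simp
  have sig: "C2 * z \<le> real \<tau> * F / \<sigma>\<^sup>2" using signal by (simp add: z_def k_def F_def)
  \<comment> \<open>The signal condition excludes F = 0, where the quotient in the delay would take
    its default value zero.\<close>
  have "0 < real \<tau> * F / \<sigma>\<^sup>2" using C20 z0 by (intro less_le_trans[OF _ sig]) simp
  then have F0: "0 < F" using \<sigma> \<tau> by (simp add: zero_less_divide_iff zero_less_mult_iff)
  have k1: "1 \<le> k"
  proof (rule ccontr)
    assume "\<not> 1 \<le> k"
    then have "card {j. j < p \<and> \<mu>2 j - \<mu>1 j \<noteq> 0} = 0" by (simp only: k_def sparsity_def)
    then have "{j. j < p \<and> \<mu>2 j - \<mu>1 j \<noteq> 0} = {}" by (simp only: card_eq_0_iff) simp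
    then have "F = 0" unfolding F by (intro sum.neutral) auto
    then show False using F0 by simp
  qed
  define y where "y = C2 * \<sigma>\<^sup>2 / F * z"
  define d where "d = nat \<lceil>y\<rceil>"
  have y0: "0 < y" using C20 \<sigma> F0 z0 by (simp add: y_def)
  \<comment> \<open>The signal condition rearranged. As \<tau> is an integer it also bounds the
    ceiling d, so 2d \<le> t \<le> 2\<tau>.\<close>
  have "y \<le> real \<tau>" using sig F0 \<sigma> by (simp add: y_def field_simps)
  then have d: "1 \<le> d" "d \<le> \<tau>" "y \<le> real d"
    using y0 by (auto simp: d_def ceiling_le_iff nat_le_iff Suc_le_eq)
  define t where "t = \<tau> + d"
  have t: "2 \<le> t" "\<tau> \<le> t" "t \<le> 2 * \<tau>" using d \<tau> by (auto simp: t_def)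
  obtain g where g: "g \<in> Ggrid t" "g \<le> d" "d < 4 * g"
    using Ggrid_approx[of d t] d by (auto simp: t_def)
  have g1: "1 \<le> g" "g < t" using Ggrid_bounds[OF t(1) g(1)] by auto
  \<comment> \<open>The CUSUM mean is a positive multiple of the mean difference, so it keeps the
    sparsity k and has squared norm c^2 F.\<close>
  define c where "c = sqrt (real g / (real t * (real t - real g))) * real \<tau> / \<sigma>"
  have c0: "0 < c" using g1 \<tau> \<sigma> by (simp add: c_def)
  define b where "b j = cusum t g j (obs_mean \<mu>1 \<mu>2 (enat \<tau>)) / \<sigma>" for j
  have b: "b j = c * (\<mu>1 j - \<mu>2 j)" for j
    unfolding b_def c_def using g1 g(2) \<tau> by (subst cusum_obs_mean) (auto simp: t_def)
  have kb: "k = card {j. j < p \<and> b j \<noteq> 0}"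
    unfolding k_def sparsity_def b using c0 by (intro arg_cong[where f = card]) auto
  have sb: "(\<Sum>j<p. (b j)\<^sup>2) = c\<^sup>2 * F"
    unfolding F sum_distrib_left b by (intro sum.cong) (auto simp: power_mult_distrib power2_commute)
  \<comment> \<open>Combines g > d/4 with t(t - g) \<le> (2\<tau>)^2, so that \<tau>^2
    cancels.\<close>
  have cl: "real d / (16 * \<sigma>\<^sup>2) \<le> c\<^sup>2"
  proof -
    have u: "0 < real t * (real t - real g)" using g1 by simp
    have "real t * (real t - real g) \<le> real t * real t" by (intro mult_left_mono) auto
    also have "\<dots> \<le> (2 * real \<tau>) * (2 * real \<tau>)" using t(3) by (intro mult_mono) auto
    finally have tt: "real t * (real t - real g) \<le> (2 * real \<tau>) * (2 * real \<tau>)" .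
    have "real d * (real t * (real t - real g)) \<le> (4 * real g) * ((2 * real \<tau>) * (2 * real \<tau>))"
      by (rule mult_mono[OF _ tt]) (use g(3) u in auto)
    then have "real d / 16 \<le> real g / (real t * (real t - real g)) * (real \<tau>)\<^sup>2"
      using u by (simp add: pos_le_divide_eq power2_eq_square mult_ac)
    then have "real d / 16 / \<sigma>\<^sup>2 \<le> real g / (real t * (real t - real g)) * (real \<tau>)\<^sup>2 / \<sigma>\<^sup>2"
      by (intro divide_right_mono) auto
    also have "\<dots> = c\<^sup>2" using g1 by (simp add: c_def power_divide power_mult_distrib)
    finally show ?thesis by simp
  qed
  have "C2 / 16 * z = y / (16 * \<sigma>\<^sup>2) * F"
    using F0 \<sigma> by (simp add: y_def)
  also have "\<dots> \<le> real d / (16 * \<sigma>\<^sup>2) * F"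
    using d(3) F0 by (intro mult_right_mono divide_right_mono) auto
  also have "\<dots> \<le> c\<^sup>2 * F"
    using cl F0 by (intro mult_right_mono) auto
  finally have "C2 / 16 * z \<le> (\<Sum>j<p. (b j)\<^sup>2)" unfolding sb .
  moreover have "C2 / 16 * zfun (real k) p (real t) \<le> C2 / 16 * z"
    unfolding z_def using p t k1 C20 by (intro mult_left_mono zfun_mono) auto
  ultimately have B: "C2 / 16 * zfun (real k) p (real t) \<le> (\<Sum>j<p. (b j)\<^sup>2)" by (rule order_trans[rotated])
  have "C2 / 16 = 2 * (2 * (16 * (8 + x)) + 15 + 3 * lam)" by (simp add: C2)
  note B = B[unfolded this]
  have "1 - 2 * exp (- x) \<le> P.prob {Y \<in> space ?P. alarm p \<sigma> lam t Y}"
    by (rule alarm_prob_ge[OF lam \<sigma> p t(1) g(1) x refl kb[unfolded b_def] k1 B[unfolded b_def]])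
  also have "\<dots> \<le> P.prob {Y \<in> space ?P. tauhat p \<sigma> lam Y \<le> enat t}"
    by (rule P.finite_measure_mono[OF _ sets_tauhat_le[OF p lam]])
       (use t in \<open>auto simp: tauhat_le_iff[OF p lam]\<close>)
  finally show ?thesis by (simp add: t_def d_def y_def F_def z_def k_def)
qed

text \<open>The quantifier order expresses the dependence of the constants: \<open>C1\<close> is
  fixed before \<open>lam\<close>, and \<open>C2\<close> before p, \<sigma> and the means. The delay
  event is written additively to avoid subtraction on extended naturals.\<close>

theorem theorem2:
  shows "\<forall>\<delta>::real. 0 < \<delta> \<and> \<delta> < 1 \<longrightarrow>
    (\<exists>C1>0. \<forall>lam>0. \<exists>C2>0.
      \<forall>(p::nat) (\<sigma>::real) (\<mu>1::nat \<Rightarrow> real) (\<mu>2::nat \<Rightarrow> real). p \<ge> 1 \<and> \<sigma> > 0 \<longrightarrow>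
        (lam \<ge> C1 \<longrightarrow>
           {Y \<in> space (Pmodel \<sigma> \<mu>1 \<mu>2 \<infinity>). tauhat p \<sigma> lam Y < \<infinity>} \<in> sets (Pmodel \<sigma> \<mu>1 \<mu>2 \<infinity>)
         \<and> measure (Pmodel \<sigma> \<mu>1 \<mu>2 \<infinity>)
             {Y \<in> space (Pmodel \<sigma> \<mu>1 \<mu>2 \<infinity>). tauhat p \<sigma> lam Y < \<infinity>} \<le> \<delta>)
      \<and> (\<forall>\<tau>::nat. \<tau> \<ge> 1 \<and>
             real \<tau> * (l2diff p \<mu>1 \<mu>2)\<^sup>2 / \<sigma>\<^sup>2
               \<ge> C2 * zfun (real (sparsity p \<mu>1 \<mu>2)) p (2 * real \<tau>) \<longrightarrow>
           measure (Pmodel \<sigma> \<mu>1 \<mu>2 (enat \<tau>))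
             {Y \<in> space (Pmodel \<sigma> \<mu>1 \<mu>2 (enat \<tau>)).
                tauhat p \<sigma> lam Y \<le> enat \<tau> + enat (nat \<lceil>C2 * \<sigma>\<^sup>2 / (l2diff p \<mu>1 \<mu>2)\<^sup>2
                    * zfun (real (sparsity p \<mu>1 \<mu>2)) p (2 * real \<tau>)\<rceil>)}
           \<ge> 1 - \<delta>))"
proof (intro allI impI, goal_cases)
  case (1 \<delta>)
  \<comment> \<open>Makes the failure probability 2 exp(-x) equal to \<delta>.\<close>
  define x where "x = ln (2 / \<delta>)"
  have x: "0 \<le> x" "2 * exp (- x) = \<delta>" using 1 by (auto simp: x_def exp_minus)
  \<comment> \<open>The condition of the false alarm bound with c = 12/\<delta>.\<close>
  let ?C1 = "16 * (12 + 12 / \<delta>)"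
  have C1: "0 < ?C1" using 1 by (simp add: add_pos_pos)
  show ?case
  proof (rule exI[of _ ?C1], rule conjI[OF C1], intro allI impI, goal_cases)
    case (1 lam)
    let ?C2 = "32 * (32 * (8 + x) + 15 + 3 * lam)"
    have C2: "0 < ?C2" using 1 x(1) by simp
    show ?case
      using false_alarm[of \<delta> _ _ "12 / \<delta>" lam] detection_delay[OF 1 _ _ _ x(1) refl] \<open>0 < \<delta> \<and> \<delta> < 1\<close>
      by (intro exI[of _ ?C2] conjI allI impI C2) (simp_all only: x(2) order_refl)
  qed
qed

end
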